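(* Let $0<r<R$ and $n\ge1$. Let $X$ be an $x$-normalized $D_R$-transversely formal vector field that has no transverse negative resonance and let $Y$ be an $x$-normalized $D_{r,R}$-transversely formal vector field. If $[X,Y]=0$, then $Y$ is an $x$-normalized $D_R$-transversely formal vector field.
   Context: Let $D_R=\{x\in\mathbb C:|x|<R\}$, $D_{r,R}=\{x\in\mathbb C: r<|x|<R\}$, and let $\mathcal O_R$, $\mathcal O_{r,R}$ be the rings of analytic functions on $D_R$, $D_{r,R}$ respectively. Let $\mathbf z=(z_1,\dots,z_n)$. $\mathcal O_{r,R}[[\mathbf z]]$ is the ring of formal power series in $\mathbf z$ with coefficients in $\mathcal O_{r,R}$ ($D_{r,R}$-transversely formal series), and $\mathcal O_R[[\mathbf z]]\subset\mathcal O_{r,R}[[\mathbf z]]$ is the subring of series with coefficients in $\mathcal O_R$ (via restriction to the annulus). A $D_{r,R}$-transversely formal vector field is a derivation of $\mathcal O_{r,R}[[\mathbf z]]$; it is $x$-normalized if it has the form $$x\partial_x+\sum_{i=1}^n\sum_{j=1}^n a_{ij}z_j\partial_{z_i}+\sum_{i=1}^n b_i(x,\mathbf z)\partial_{z_i},$$ with $(a_{ij})$ a constant complex matrix and every $b_i$ in the ideal of $\mathcal O_{r,R}[[\mathbf z]]$ generated by the monomials $z_kz_l$, $1\le k,l\le n$. An $x$-normalized $D_R$-transversely formal vector field is defined in the same way with $\mathcal O_R$ in place of $\mathcal O_{r,R}$; it is regarded as a derivation of $\mathcal O_{r,R}[[\mathbf z]]$ as well. The Lie bracket is $[X,Y]=X\circ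 Y-Y\circ X$. Let $\mu_1,\dots,\mu_n$ be the eigenvalues of $(a_{ij})$ for $X$ (so $1,\mu_1,\dots,\mu_n$ are the eigenvalues of the linear part of $X$). $X$ has no transverse negative resonance if no number $\sum_i p_i\mu_i$ with $p_i\in\mathbb Z_{\ge0}$, $\sum_i p_i\ge1$, can be written as $\mu_j+q$ with $q\in\mathbb Z_{\ge1}$ and $1\le j\le n$. *)

theory Defs
  imports "HOL-Complex_Analysis.Complex_Analysis" "HOL-Algebra.Ideal"
begin

definition annulus :: "real \<Rightarrow> real \<Rightarrow> complex set" where
  "annulus r R = {x. r < cmod x \<and> cmod x < R}"

text \<open>A formal series in the variables \<open>z\<^sub>i\<close> (\<open>i :: 'n\<close>) maps a multi-index to a coefficient, which is a
  function of \<open>x\<close>. Coefficients over \<open>U\<close> vanish outside \<open>U\<close>, so that equality in HOL is equality of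
  functions on \<open>U\<close>.\<close>

type_synonym 'n tf_series = "('n \<Rightarrow> nat) \<Rightarrow> complex \<Rightarrow> complex"

definition tf_coeff :: "complex set \<Rightarrow> (complex \<Rightarrow> complex) \<Rightarrow> 'n tf_series" where
  "tf_coeff U g = (\<lambda>\<alpha> x. if \<alpha> = (\<lambda>_. 0) \<and> x \<in> U then g x else 0)"

definition tf_var :: "complex set \<Rightarrow> 'n \<Rightarrow> 'n tf_series" where
  "tf_var U i = (\<lambda>\<alpha> x. if \<alpha> = (\<lambda>_. 0)(i := 1) \<and> x \<in> U then 1 else 0)"

definition tf_ring :: "complex set \<Rightarrow> ('n::finite) tf_series ring" where
  "tf_ring U =
     \<lparr>carrier = {f. \<forall>\<alpha>. f \<alpha> holomorphic_on U \<and> (\<forall>x. x \<notin> U \<longrightarrow> f \<alpha> x = 0)},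
      mult = (\<lambda>f g \<alpha> x. \<Sum>(\<beta>, \<gamma>)\<in>{(\<beta>, \<gamma>). (\<lambda>i. \<beta> i + \<gamma> i) = \<alpha>}. f \<beta> x * g \<gamma> x),
      one = tf_coeff U (\<lambda>_. 1),
      zero = (\<lambda>\<alpha> x. 0),
      add = (\<lambda>f g \<alpha> x. f \<alpha> x + g \<alpha> x)\<rparr>"

lemma finite_multi_index_sums: "finite {(\<beta>, \<gamma>). (\<lambda>i::'n::finite. \<beta> i + \<gamma> i) = (\<alpha> :: 'n \<Rightarrow> nat)}"
proof -
  have "finite (Pi\<^sub>E UNIV (\<lambda>i. {..\<alpha> i}))"
    by (intro finite_PiE) auto
  hence "finite {\<beta>. \<forall>i. \<beta> i \<le> \<alpha> i}"
    by (rule rev_finite_subset) (auto simp: PiE_UNIV_domain)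
  from finite_cartesian_product[OF this this] show ?thesis
    by (rule rev_finite_subset) auto
qed

lemma tf_ring_simps:
  "carrier (tf_ring U) = {f. \<forall>\<alpha>. f \<alpha> holomorphic_on U \<and> (\<forall>x. x \<notin> U \<longrightarrow> f \<alpha> x = 0)}"
  "f \<otimes>\<^bsub>tf_ring U\<^esub> g = (\<lambda>\<alpha> x. \<Sum>(\<beta>, \<gamma>)\<in>{(\<beta>, \<gamma>). (\<lambda>i. \<beta> i + \<gamma> i) = \<alpha>}. f \<beta> x * g \<gamma> x)"
  "\<one>\<^bsub>tf_ring U\<^esub> = tf_coeff U (\<lambda>_. 1)"
  "\<zero>\<^bsub>tf_ring U\<^esub> = (\<lambda>\<alpha> x. 0)"
  "f \<oplus>\<^bsub>tf_ring U\<^esub> g = (\<lambda>\<alpha> x. f \<alpha> x + g \<alpha> x)"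
  by (simp_all add: tf_ring_def)

text \<open>In particular ideals generated in \<open>tf_ring U\<close> and finite sums have their usual meaning.\<close>

lemma cring_tf_ring: "cring (tf_ring U :: ('n::finite) tf_series ring)"
proof (rule cringI)
  let ?R = "tf_ring U :: 'n tf_series ring"
  show "abelian_group ?R"
  proof (rule abelian_groupI)
    fix f assume f: "f \<in> carrier ?R"
    show "\<exists>g\<in>carrier ?R. g \<oplus>\<^bsub>?R\<^esub> f = \<zero>\<^bsub>?R\<^esub>"
      using f by (intro bexI[of _ "\<lambda>\<alpha> x. - f \<alpha> x"]) (auto simp: tf_ring_simps intro!: holomorphic_intros)
  qed (auto simp: tf_ring_simps algebra_simps intro!: holomorphic_intros)
  have comm: "f \<otimes>\<^bsub>?R\<^esub> g = g \<otimes>\<^bsub>?R\<^esub> f" for f g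
  proof (intro ext)
    fix \<alpha> x
    show "(f \<otimes>\<^bsub>?R\<^esub> g) \<alpha> x = (g \<otimes>\<^bsub>?R\<^esub> f) \<alpha> x"
      unfolding tf_ring_simps
      by (rule sum.reindex_bij_witness[of _ prod.swap prod.swap])
         (auto simp: mult.commute add.commute)
  qed
  show "comm_monoid ?R"
  proof (rule comm_monoidI)
    have "tf_coeff U (\<lambda>_. 1) \<alpha> holomorphic_on U" for \<alpha> :: "'n \<Rightarrow> nat"
      by (rule holomorphic_transform[of "\<lambda>_. if \<alpha> = (\<lambda>_. 0) then 1 else 0"])
         (auto simp: tf_coeff_def)
    thus "\<one>\<^bsub>?R\<^esub> \<in> carrier ?R"
      by (auto simp: tf_ring_simps) (simp add: tf_coeff_def)
    show "f \<otimes>\<^bsub>?R\<^esub> g \<in> carrier ?R" if "f \<in> carrier ?R" "g \<in> carrier ?R" for f g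
      using that by (auto simp: tf_ring_simps case_prod_unfold intro!: holomorphic_intros sum.neutral)
    show "f \<otimes>\<^bsub>?R\<^esub> g = g \<otimes>\<^bsub>?R\<^esub> f" for f g by (rule comm)
    show "\<one>\<^bsub>?R\<^esub> \<otimes>\<^bsub>?R\<^esub> f = f" if f: "f \<in> carrier ?R" for f
    proof (intro ext)
      fix \<alpha> :: "'n \<Rightarrow> nat" and x
      let ?S = "{(\<beta>, \<gamma>). (\<lambda>i. \<beta> i + \<gamma> i) = \<alpha>}"
      have "(\<one>\<^bsub>?R\<^esub> \<otimes>\<^bsub>?R\<^esub> f) \<alpha> x
          = (\<Sum>p\<in>?S. if p = ((\<lambda>_. 0), \<alpha>) then (if x \<in> U then f \<alpha> x else 0) else 0)"
        unfolding tf_ring_simps by (intro sum.cong) (auto simp: tf_coeff_def split: if_splits)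
      also have "\<dots> = f \<alpha> x"
        using f by (subst sum.delta[OF finite_multi_index_sums]) (auto simp: tf_ring_simps)
      finally show "(\<one>\<^bsub>?R\<^esub> \<otimes>\<^bsub>?R\<^esub> f) \<alpha> x = f \<alpha> x" .
    qed
    show "f \<otimes>\<^bsub>?R\<^esub> g \<otimes>\<^bsub>?R\<^esub> h = f \<otimes>\<^bsub>?R\<^esub> (g \<otimes>\<^bsub>?R\<^esub> h)" for f g h
    proof (intro ext)
      fix \<alpha> x
      let ?S = "\<lambda>\<alpha>. {(\<beta>, \<gamma>). (\<lambda>i. \<beta> i + \<gamma> i) = (\<alpha> :: 'n \<Rightarrow> nat)}"
      have "(f \<otimes>\<^bsub>?R\<^esub> g \<otimes>\<^bsub>?R\<^esub> h) \<alpha> x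
          = (\<Sum>p\<in>?S \<alpha>. \<Sum>q\<in>?S (fst p). f (fst q) x * g (snd q) x * h (snd p) x)"
        by (simp add: tf_ring_simps case_prod_unfold sum_distrib_right)
      also have "\<dots> = (\<Sum>(p, q)\<in>Sigma (?S \<alpha>) (\<lambda>p. ?S (fst p)). f (fst q) x * g (snd q) x * h (snd p) x)"
        by (rule sum.Sigma) (use finite_multi_index_sums in auto)
      also have "\<dots> = (\<Sum>(p, q)\<in>Sigma (?S \<alpha>) (\<lambda>p. ?S (snd p)). f (fst p) x * (g (fst q) x * h (snd q) x))"
        by (rule sum.reindex_bij_witness
              [of _ "\<lambda>(p, q). (((\<lambda>i. fst p i + fst q i), snd q), (fst p, fst q))"
                    "\<lambda>(p, q). ((fst q, (\<lambda>i. snd q i + snd p i)), (snd q, snd p))"])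
           (auto simp: add.assoc mult.assoc)
      also have "\<dots> = (\<Sum>p\<in>?S \<alpha>. \<Sum>q\<in>?S (snd p). f (fst p) x * (g (fst q) x * h (snd q) x))"
        by (rule sum.Sigma[symmetric]) (use finite_multi_index_sums in auto)
      also have "\<dots> = (f \<otimes>\<^bsub>?R\<^esub> (g \<otimes>\<^bsub>?R\<^esub> h)) \<alpha> x"
        by (simp add: tf_ring_simps case_prod_unfold sum_distrib_left)
      finally show "(f \<otimes>\<^bsub>?R\<^esub> g \<otimes>\<^bsub>?R\<^esub> h) \<alpha> x = (f \<otimes>\<^bsub>?R\<^esub> (g \<otimes>\<^bsub>?R\<^esub> h)) \<alpha> x" .
    qed
  qed
  fix f g h assume "f \<in> carrier ?R" "g \<in> carrier ?R" "h \<in> carrier ?R"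
  show "(f \<oplus>\<^bsub>?R\<^esub> g) \<otimes>\<^bsub>?R\<^esub> h = f \<otimes>\<^bsub>?R\<^esub> h \<oplus>\<^bsub>?R\<^esub> g \<otimes>\<^bsub>?R\<^esub> h"
    by (simp add: tf_ring_simps case_prod_unfold distrib_right sum.distrib)
qed

definition tf_dx :: "complex set \<Rightarrow> 'n tf_series \<Rightarrow> 'n tf_series" where
  "tf_dx U f = (\<lambda>\<alpha> x. if x \<in> U then deriv (f \<alpha>) x else 0)"

definition tf_dz :: "'n \<Rightarrow> 'n tf_series \<Rightarrow> 'n tf_series" where
  "tf_dz i f = (\<lambda>\<alpha> x. of_nat (Suc (\<alpha> i)) * f (\<alpha>(i := Suc (\<alpha> i))) x)"

definition tf_restrict :: "complex set \<Rightarrow> 'n tf_series \<Rightarrow> 'n tf_series" where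
  "tf_restrict V f = (\<lambda>\<alpha> x. if x \<in> V then f \<alpha> x else 0)"

text \<open>Derivations are derivations over the field of complex numbers.\<close>

definition tf_derivation ::
    "complex set \<Rightarrow> (('n::finite) tf_series \<Rightarrow> 'n tf_series) \<Rightarrow> bool" where
  "tf_derivation U D \<longleftrightarrow>
     (let \<R> = tf_ring U in
       D \<in> carrier \<R> \<rightarrow> carrier \<R> \<and>
       (\<forall>f\<in>carrier \<R>. \<forall>g\<in>carrier \<R>. D (f \<oplus>\<^bsub>\<R>\<^esub> g) = D f \<oplus>\<^bsub>\<R>\<^esub> D g) \<and>
       (\<forall>c. \<forall>f\<in>carrier \<R>. D (tf_coeff U (\<lambda>_. c) \<otimes>\<^bsub>\<R>\<^esub> f) = tf_coeff U (\<lambda>_. c) \<otimes>\<^bsub>\<R>\<^esub> D f) \<and>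
       (\<forall>f\<in>carrier \<R>. \<forall>g\<in>carrier \<R>. D (f \<otimes>\<^bsub>\<R>\<^esub> g) = D f \<otimes>\<^bsub>\<R>\<^esub> g \<oplus>\<^bsub>\<R>\<^esub> f \<otimes>\<^bsub>\<R>\<^esub> D g))"

definition lie_bracket ::
    "complex set \<Rightarrow> (('n::finite) tf_series \<Rightarrow> 'n tf_series) \<Rightarrow> ('n tf_series \<Rightarrow> 'n tf_series)
      \<Rightarrow> 'n tf_series \<Rightarrow> 'n tf_series" where
  "lie_bracket U X Y f = X (Y f) \<ominus>\<^bsub>tf_ring U\<^esub> Y (X f)"

definition quadratic_ideal :: "complex set \<Rightarrow> ('n::finite) tf_series set" where
  "quadratic_ideal U = Idl\<^bsub>tf_ring U\<^esub> {tf_var U k \<otimes>\<^bsub>tf_ring U\<^esub> tf_var U l | k l. True}"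

text \<open>The operator
  \<open>x \<partial>\<^sub>x + (\<Sum>i. \<Sum>j. A\<^sub>i\<^sub>j z\<^sub>j \<partial>\<^sub>z\<^sub>i) + (\<Sum>i. b\<^sub>i \<partial>\<^sub>z\<^sub>i)\<close>
  on the series over \<open>U\<close>.\<close>

definition x_normal_form ::
    "complex set \<Rightarrow> complex ^ 'n ^ 'n \<Rightarrow> ('n \<Rightarrow> 'n tf_series) \<Rightarrow> ('n::finite) tf_series \<Rightarrow> 'n tf_series" where
  "x_normal_form U A b f =
     (let \<R> = tf_ring U in
       (tf_coeff U (\<lambda>x. x) \<otimes>\<^bsub>\<R>\<^esub> tf_dx U f)
       \<oplus>\<^bsub>\<R>\<^esub> (\<Oplus>\<^bsub>\<R>\<^esub>i\<in>UNIV. \<Oplus>\<^bsub>\<R>\<^esub>j\<in>UNIV.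
              tf_coeff U (\<lambda>_. A $ i $ j) \<otimes>\<^bsub>\<R>\<^esub> tf_var U j \<otimes>\<^bsub>\<R>\<^esub> tf_dz i f)
       \<oplus>\<^bsub>\<R>\<^esub> (\<Oplus>\<^bsub>\<R>\<^esub>i\<in>UNIV. b i \<otimes>\<^bsub>\<R>\<^esub> tf_dz i f))"

text \<open>For \<open>V \<subseteq> U\<close>: \<open>X\<close>, a derivation of the series over \<open>V\<close>, is an \<open>x\<close>-normalized
  \<open>U\<close>-transversely formal vector field (with linear part \<open>A\<close>) regarded as a derivation over \<open>V\<close>, that
  is, its coefficients \<open>b\<^sub>i\<close> are restrictions to \<open>V\<close> of elements of the ideal over \<open>U\<close>. For \<open>U = V\<close> the
  restriction is the identity.\<close>

definition x_normalized_linear ::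
    "complex set \<Rightarrow> complex set \<Rightarrow> complex ^ 'n ^ 'n
      \<Rightarrow> (('n::finite) tf_series \<Rightarrow> 'n tf_series) \<Rightarrow> bool" where
  "x_normalized_linear U V A X \<longleftrightarrow>
     tf_derivation V X \<and>
     (\<exists>b. (\<forall>i. b i \<in> quadratic_ideal U) \<and>
          (\<forall>f\<in>carrier (tf_ring V). X f = x_normal_form V A (\<lambda>i. tf_restrict V (b i)) f))"

definition x_normalized ::
    "complex set \<Rightarrow> complex set \<Rightarrow> (('n::finite) tf_series \<Rightarrow> 'n tf_series) \<Rightarrow> bool" where
  "x_normalized U V X \<longleftrightarrow> (\<exists>A. x_normalized_linear U V A X)"

text \<open>The family \<open>\<mu>\<close> lists the eigenvalues of \<open>A\<close> with algebraic multiplicity.\<close>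

definition eigenvalue_family :: "complex ^ 'n ^ 'n \<Rightarrow> ('n::finite \<Rightarrow> complex) \<Rightarrow> bool" where
  "eigenvalue_family A \<mu> \<longleftrightarrow> (\<forall>t. det (mat t - A) = (\<Prod>i\<in>UNIV. t - \<mu> i))"

definition no_transverse_negative_resonance :: "('n::finite \<Rightarrow> complex) \<Rightarrow> bool" where
  "no_transverse_negative_resonance \<mu> \<longleftrightarrow>
     \<not> (\<exists>(p :: 'n \<Rightarrow> nat) (q :: nat) j.
          (\<Sum>i\<in>UNIV. p i) \<ge> 1 \<and> q \<ge> 1 \<and> (\<Sum>i\<in>UNIV. of_nat (p i) * \<mu> i) = \<mu> j + of_nat q)"

end

theory Submission
  imports Defs
begin

text \<open>Applying \<open>[X, Y] = 0\<close> to \<open>z\<^sub>k\<close> and comparing coefficients of degree \<open>m\<close> gives, for the vector \<open>c\<close> of the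
  degree-\<open>m\<close> coefficients of \<open>Y\<close>, a linear system \<open>x c' + L c = g\<close> on the annulus. Here \<open>L\<close> is the action
  of \<open>A z \<partial>\<^sub>z\<close> on homogeneous vector fields of degree \<open>m\<close>, and \<open>g\<close> involves only coefficients of \<open>X\<close> and
  coefficients of \<open>Y\<close> of smaller degree, so by induction it extends to the disc. Hence the Laurent
  coefficient of \<open>c\<close> at \<open>x\<^bsup>-q\<^esup>\<close>, \<open>q \<ge> 1\<close>, lies in the kernel of \<open>L - q\<close>. The eigenvalues of \<open>L\<close> are the
  numbers \<open>\<Sum>p\<^sub>i \<mu>\<^sub>i - \<mu>\<^sub>j\<close> with \<open>\<Sum>p\<^sub>i = m\<close>, so this kernel is trivial in the absence of negative
  resonances. Therefore \<open>c\<close> has no negative Laurent coefficients, and it extends to the disc.\<close>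

section \<open>Matrix eigenvalue problems for linear vector fields\<close>

text \<open>The conditional under \<open>\<chi>\<close> is the form in which
  \<open>det_linear_row_sum\<close> and \<open>det_row_mul\<close> express multilinearity of
  \<open>det\<close>.\<close>

definition row_replaced :: "'a^'n^'n \<Rightarrow> 'n \<Rightarrow> 'a^'n \<Rightarrow> 'a^'n^'n" where
  "row_replaced A k v = (\<chi> i. if i = k then v else row i A)"

lemma det_row_replaced_row:
  fixes A :: "'a::comm_ring_1^'n^'n"
  shows "det (row_replaced A k (row j A)) = (if j = k then det A else 0)"
proof (cases "j = k")
  case True
  have "row_replaced A k (row k A) = A"
    by (simp add: row_replaced_def row_def vec_eq_iff)
  thus ?thesis using True by simp
next
  case False
  have "row j (row_replaced A k (row j A)) = row k (row_replaced A k (row j A))"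
    using False by (simp add: row_replaced_def row_def vec_eq_iff)
  from det_identical_rows[OF False this] show ?thesis using False by simp
qed

text \<open>Linearity in the replaced row turns the sum into the determinant of the transpose with
  row k replaced by row j, which has two equal rows unless j = k. This is entry (k, j) of adj(A) A =
  det(A) I, the determinants on the left being cofactors. It is applied to polynomial
  entries.\<close>

lemma sum_mult_cofactor:
  fixes A :: "'a::comm_ring_1^'n^'n"
  shows "(\<Sum>i\<in>UNIV. det (row_replaced (transpose A) k (axis i 1)) * A $ i $ j)
    = (if j = k then det A else 0)"
proof -
  let ?B = "transpose A"
  have "row j ?B = (\<Sum>i\<in>UNIV. A $ i $ j *s axis i 1)"
    by (simp add: vec_eq_iff row_def transpose_def axis_def if_distrib cong: if_cong)
  hence "det (row_replaced ?B k (row j ?B))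
      = (\<Sum>i\<in>UNIV. A $ i $ j * det (row_replaced ?B k (axis i 1)))"
    unfolding row_replaced_def
    by (simp add: det_linear_row_sum[of _ _ "\<lambda>_ i. A $ i $ j *s axis i 1"]
        det_row_mul[of _ _ "\<lambda>_. axis _ 1"] cong: if_cong)
  thus ?thesis by (simp only: det_row_replaced_row det_transpose mult.commute)
qed

section \<open>Polynomials in a linear operator\<close>

text \<open>This is p(D) f, the action that makes the functions a module over
  \<open>complex poly\<close> with the indeterminate acting as D.\<close>

definition poly_act ::
    "(('a \<Rightarrow> complex) \<Rightarrow> 'a \<Rightarrow> complex) \<Rightarrow> complex poly \<Rightarrow> ('a \<Rightarrow> complex) \<Rightarrow> 'a \<Rightarrow> complex" where
  "poly_act D p f = (\<lambda>a. \<Sum>k\<le>degree p. coeff p k * (D ^^ k) f a)"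

locale linear_operator =
  fixes D :: "('a \<Rightarrow> complex) \<Rightarrow> 'a \<Rightarrow> complex"
  assumes add: "D (\<lambda>a. f a + g a) = (\<lambda>a. D f a + D g a)"
    and scale: "D (\<lambda>a. c * f a) = (\<lambda>a. c * D f a)"
begin

lemma zero: "D (\<lambda>_. 0) = (\<lambda>_. 0)"
  using scale[of 0 "\<lambda>_. 0"] by simp

lemma sum: "D (\<lambda>a. \<Sum>i\<in>I. f i a) = (\<lambda>a. \<Sum>i\<in>I. D (f i) a)"
proof (cases "finite I")
  case True
  thus ?thesis by induction (simp_all add: zero add)
qed (simp add: zero)

text \<open>Gives freedom in the summation bound, since \<open>pCons c p\<close> has degree
  \<open>Suc (degree p)\<close> only for nonzero p.\<close>

lemma poly_act_bound:
  assumes "degree p \<le> N"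
  shows "poly_act D p f a = (\<Sum>k\<le>N. coeff p k * (D ^^ k) f a)"
  unfolding poly_act_def using assms
  by (intro sum.mono_neutral_left) (auto simp: coeff_eq_0)

text \<open>Horner's rule, the recursion behind the following inductions over polynomials.\<close>

lemma poly_act_pCons: "poly_act D (pCons c p) f = (\<lambda>a. c * f a + D (poly_act D p f) a)"
proof
  fix a
  have "poly_act D (pCons c p) f a = (\<Sum>k\<le>Suc (degree p). coeff (pCons c p) k * (D ^^ k) f a)"
    by (rule poly_act_bound) (rule degree_pCons_le)
  also have "\<dots> = c * f a + (\<Sum>k\<le>degree p. coeff p k * D ((D ^^ k) f) a)"
    by (subst sum.atMost_Suc_shift) simp
  also have "(\<Sum>k\<le>degree p. coeff p k * D ((D ^^ k) f) a) = D (poly_act D p f) a"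
    by (simp add: poly_act_def sum scale)
  finally show "poly_act D (pCons c p) f a = c * f a + D (poly_act D p f) a" .
qed

lemma poly_act_0: "poly_act D 0 f = (\<lambda>_. 0)"
  by (simp add: poly_act_def)

lemma poly_act_add: "poly_act D (p + q) f = (\<lambda>a. poly_act D p f a + poly_act D q f a)"
  by (induction p q rule: poly_induct2) (simp_all add: poly_act_0 poly_act_pCons add algebra_simps)

lemma poly_act_smult: "poly_act D (smult c p) f = (\<lambda>a. c * poly_act D p f a)"
  by (induction p) (simp_all add: poly_act_0 poly_act_pCons scale algebra_simps)

text \<open>As \<open>p * q = q * p\<close>, any two polynomials in D commute, so factors of a
  product may act in any order.\<close>

lemma poly_act_mult: "poly_act D (p * q) f = poly_act D p (poly_act D q f)"
  by (induction p)
    (simp_all add: poly_act_0 poly_act_pCons poly_act_add poly_act_smult zero)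

lemma poly_act_poly_sum: "poly_act D (\<Sum>i\<in>I. p i) f = (\<lambda>a. \<Sum>i\<in>I. poly_act D (p i) f a)"
proof (cases "finite I")
  case True
  thus ?thesis by induction (simp_all add: poly_act_0 poly_act_add)
qed (simp add: poly_act_0)

lemma linear_operator_poly_act: "linear_operator (poly_act D p)"
proof
  fix f g :: "'a \<Rightarrow> complex" and c :: complex
  show "poly_act D p (\<lambda>a. f a + g a) = (\<lambda>a. poly_act D p f a + poly_act D p g a)"
    by (induction p) (simp_all add: poly_act_0 poly_act_pCons add algebra_simps)
  show "poly_act D p (\<lambda>a. c * f a) = (\<lambda>a. c * poly_act D p f a)"
    by (induction p) (simp_all add: poly_act_0 poly_act_pCons scale algebra_simps)
qed

text \<open>Each factor \<open>D - \<mu> j\<close> maps S into itself and is injective there, hence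
  so is the product. S will be the homogeneous series of one degree.\<close>

lemma poly_act_prod_eq_0D:
  assumes S: "\<And>f c. f \<in> S \<Longrightarrow> (\<lambda>a. D f a - c * f a) \<in> S"
    and inj: "\<And>f j. j \<in> J \<Longrightarrow> f \<in> S \<Longrightarrow> D f = (\<lambda>a. \<mu> j * f a) \<Longrightarrow> f = (\<lambda>_. 0)"
    and "finite J" "f \<in> S" "poly_act D (\<Prod>j\<in>J. [:- \<mu> j, 1:]) f = (\<lambda>_. 0)"
  shows "f = (\<lambda>_. 0)"
  using \<open>finite J\<close> assms(2,4-)
proof (induction J arbitrary: f)
  case empty
  thus ?case by (simp add: one_pCons poly_act_pCons poly_act_0 zero)
next
  case (insert j J)
  have lin: "poly_act D [:- \<mu> j, 1:] f = (\<lambda>a. D f a - \<mu> j * f a)"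
    by (simp add: poly_act_pCons poly_act_0 zero)
  \<comment> \<open>Let the factor for j act first: its result stays in S and is killed by the
    remaining product.\<close>
  have "(\<lambda>a. D f a - \<mu> j * f a) = (\<lambda>_. 0)"
  proof (rule insert.IH)
    show "poly_act D (\<Prod>j\<in>J. [:- \<mu> j, 1:]) (\<lambda>a. D f a - \<mu> j * f a) = (\<lambda>_. 0)"
      using insert.prems(3) insert.hyps
      by (simp only: prod.insert mult.commute[of "[:- \<mu> j, 1:]"] poly_act_mult lin not_False_eq_True)
  qed (use insert.prems S in auto)
  hence "D f = (\<lambda>a. \<mu> j * f a)" by (simp add: fun_eq_iff)
  thus ?case using insert.prems by blast
qed

text \<open>Multiply \<open>(D - M) G = 0\<close> by the adjugate of the matrix \<open>D - M\<close> over the commutative ring of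
  polynomials in \<open>D\<close>; the determinant of \<open>D - M\<close> is a product of injective operators.\<close>

lemma matrix_eigen_system_trivial:
  fixes G :: "'n::finite \<Rightarrow> 'a \<Rightarrow> complex" and M :: "complex^'n^'n"
  assumes S: "\<And>f c. f \<in> S \<Longrightarrow> (\<lambda>a. D f a - c * f a) \<in> S"
    and inj: "\<And>f j. f \<in> S \<Longrightarrow> D f = (\<lambda>a. \<mu> j * f a) \<Longrightarrow> f = (\<lambda>_. 0)"
    and \<mu>: "eigenvalue_family M \<mu>"
    and G: "\<And>i. G i \<in> S"
    and eq: "\<And>i. D (G i) = (\<lambda>a. \<Sum>j\<in>UNIV. M $ i $ j * G j a)"
  shows "G k = (\<lambda>_. 0)"
proof -
  \<comment> \<open>N is the characteristic matrix t - M with t the polynomial indeterminate, so its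
    entries can act through D.\<close>
  define N :: "complex poly^'n^'n" where "N = (\<chi> i j. [:- M $ i $ j, if i = j then 1 else 0:])"
  have "poly (det N) t = poly (\<Prod>j\<in>UNIV. [:- \<mu> j, 1:]) t" for t
  proof -
    have "poly (det N) t = det (mat t - M)"
      by (simp add: det_def N_def poly_sum poly_prod mat_def)
         (intro sum.cong prod.cong arg_cong2[where f = "(*)"], auto)
    also have "\<dots> = (\<Prod>j\<in>UNIV. t - \<mu> j)"
      using \<mu> by (simp add: eigenvalue_family_def)
    finally show ?thesis by (simp add: poly_prod)
  qed
  hence det: "det N = (\<Prod>j\<in>UNIV. [:- \<mu> j, 1:])"
    using poly_eq_poly_eq_iff by blast
  \<comment> \<open>\<open>c i\<close> is entry (k, i) of the adjugate of N.\<close>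
  define c where "c = (\<lambda>i. det (row_replaced (transpose N) k (axis i 1)))"
  have row: "(\<Sum>j\<in>UNIV. poly_act D (N $ i $ j) (G j) a) = 0" for i a
  proof -
    have "(\<Sum>j\<in>UNIV. poly_act D (N $ i $ j) (G j) a)
        = (\<Sum>j\<in>UNIV. (if i = j then D (G j) a else 0) - M $ i $ j * G j a)"
      by (intro sum.cong) (auto simp: N_def poly_act_pCons poly_act_0 zero)
    also have "\<dots> = 0" by (simp add: sum_subtractf eq)
    finally show ?thesis .
  qed
  have "poly_act D (det N) (G k) a = 0" for a
  proof -
    \<comment> \<open>Write det(N) G_k as row k of det(N) I applied to G, replace det(N) I by adj(N)
      N, and sum over j first: each row of N annihilates G.\<close>
    have "poly_act D (det N) (G k) a
        = (\<Sum>j\<in>UNIV. poly_act D (if j = k then det N else 0) (G j) a)"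
      by (simp add: if_distrib[of "\<lambda>p. poly_act D p _ a"] poly_act_0 cong: if_cong)
    also have "\<dots> = (\<Sum>j\<in>UNIV. \<Sum>i\<in>UNIV. poly_act D (c i) (poly_act D (N $ i $ j) (G j)) a)"
      by (simp add: sum_mult_cofactor[symmetric] c_def poly_act_poly_sum poly_act_mult)
    also have "\<dots> = (\<Sum>i\<in>UNIV. poly_act D (c i) (\<lambda>a. \<Sum>j\<in>UNIV. poly_act D (N $ i $ j) (G j) a) a)"
      by (subst sum.swap) (simp add: linear_operator.sum[OF linear_operator_poly_act])
    also have "\<dots> = 0"
      by (simp add: row linear_operator.zero[OF linear_operator_poly_act])
    finally show ?thesis .
  qed
  hence "poly_act D (\<Prod>j\<in>UNIV. [:- \<mu> j, 1:]) (G k) = (\<lambda>_. 0)"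
    by (simp add: det fun_eq_iff)
  from poly_act_prod_eq_0D[OF S _ _ G this] inj show ?thesis by simp
qed

end

section \<open>The linear vector field acting on coefficient functions\<close>

text \<open>The variable x is absent, so that the same operator applies to a series at one fixed x
  and to the contour integrals of its coefficients.\<close>

definition zderiv :: "'n \<Rightarrow> (('n \<Rightarrow> nat) \<Rightarrow> complex) \<Rightarrow> ('n \<Rightarrow> nat) \<Rightarrow> complex" where
  "zderiv i P = (\<lambda>\<alpha>. of_nat (Suc (\<alpha> i)) * P (\<alpha>(i := Suc (\<alpha> i))))"

text \<open>Multiplication by z_j; the case distinction guards against truncated
  subtraction.\<close>

definition zmult :: "'n \<Rightarrow> (('n \<Rightarrow> nat) \<Rightarrow> complex) \<Rightarrow> ('n \<Rightarrow> nat) \<Rightarrow> complex" where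
  "zmult j P = (\<lambda>\<alpha>. if \<alpha> j = 0 then 0 else P (\<alpha>(j := \<alpha> j - 1)))"

definition linear_field ::
    "complex^'n^'n \<Rightarrow> (('n::finite \<Rightarrow> nat) \<Rightarrow> complex) \<Rightarrow> ('n \<Rightarrow> nat) \<Rightarrow> complex" where
  "linear_field A P = (\<lambda>\<alpha>. \<Sum>i\<in>UNIV. \<Sum>j\<in>UNIV. A $ i $ j * zmult j (zderiv i P) \<alpha>)"

definition homogeneous :: "nat \<Rightarrow> (('n::finite \<Rightarrow> nat) \<Rightarrow> complex) set" where
  "homogeneous m = {P. \<forall>\<alpha>. sum \<alpha> UNIV \<noteq> m \<longrightarrow> P \<alpha> = 0}"

lemma sum_fun_upd_Suc: "sum (\<alpha>(i := Suc (\<alpha> i))) (UNIV :: 'n::finite set) = Suc (sum \<alpha> UNIV)"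
  by (simp add: sum.remove[of UNIV i])

lemma sum_fun_upd_diff:
  "\<alpha> i \<noteq> 0 \<Longrightarrow> Suc (sum (\<alpha>(i := \<alpha> i - 1)) (UNIV :: 'n::finite set)) = sum \<alpha> UNIV"
  by (simp add: sum.remove[of UNIV i])

lemma zderiv_homogeneous: "P \<in> homogeneous (Suc m) \<Longrightarrow> zderiv i P \<in> homogeneous m"
  unfolding homogeneous_def zderiv_def
  by (auto simp del: mult_eq_0_iff) (metis mult_zero_right nat.inject sum_fun_upd_Suc)

lemma zderiv_homogeneous_0: "P \<in> homogeneous 0 \<Longrightarrow> zderiv i P = (\<lambda>_. 0)"
  using sum_fun_upd_Suc[of _ i] by (auto simp: homogeneous_def zderiv_def fun_eq_iff simp del: sum_eq_0_iff)

text \<open>The operator z_j d/dz_i preserves the total degree, so each degree can be treated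
  separately.\<close>

lemma zmult_zderiv_cong:
  fixes \<alpha> :: "'n::finite \<Rightarrow> nat"
  assumes "\<And>\<beta>. sum \<beta> UNIV = sum \<alpha> UNIV \<Longrightarrow> P \<beta> = Q \<beta>"
  shows "zmult j (zderiv i P) \<alpha> = zmult j (zderiv i Q) \<alpha>"
proof (cases "\<alpha> j = 0")
  case False
  have "sum ((\<alpha>(j := \<alpha> j - 1))(i := Suc ((\<alpha>(j := \<alpha> j - 1)) i))) UNIV = sum \<alpha> UNIV"
    using sum_fun_upd_Suc[of "\<alpha>(j := \<alpha> j - 1)" i] sum_fun_upd_diff[of \<alpha> j, OF False] by simp
  from assms[OF this] False show ?thesis by (simp add: zmult_def zderiv_def)
qed (simp add: zmult_def)

lemma linear_field_cong:
  assumes "\<And>\<beta>. sum \<beta> UNIV = sum \<alpha> UNIV \<Longrightarrow> P \<beta> = Q \<beta>"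
  shows "linear_field A P \<alpha> = linear_field A Q \<alpha>"
  unfolding linear_field_def
  using zmult_zderiv_cong[of \<alpha> P Q] assms by simp

lemma linear_field_homogeneous:
  assumes "P \<in> homogeneous m" shows "linear_field A P \<in> homogeneous m"
proof -
  have "linear_field A P \<alpha> = linear_field A (\<lambda>_. 0) \<alpha>" if "sum \<alpha> UNIV \<noteq> m" for \<alpha>
    using assms that by (intro linear_field_cong) (auto simp: homogeneous_def)
  thus ?thesis by (simp add: homogeneous_def linear_field_def zmult_def zderiv_def)
qed

lemma linear_operator_linear_field: "linear_operator (linear_field A)"
proof
  fix f g :: "('a \<Rightarrow> nat) \<Rightarrow> complex" and c :: complex
  show "linear_field A (\<lambda>a. f a + g a) = (\<lambda>a. linear_field A f a + linear_field A g a)"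
    by (simp add: linear_field_def zmult_def zderiv_def fun_eq_iff flip: sum.distrib)
       (auto intro!: sum.cong simp: algebra_simps)
  show "linear_field A (\<lambda>a. c * f a) = (\<lambda>a. c * linear_field A f a)"
    by (simp add: linear_field_def zmult_def zderiv_def fun_eq_iff sum_distrib_left)
       (auto intro!: sum.cong simp: algebra_simps)
qed

lemma zderiv_commute: "zderiv i (zderiv j P) = zderiv j (zderiv i P)"
  by (cases "i = j") (auto simp: zderiv_def fun_eq_iff fun_upd_twist algebra_simps)

text \<open>The commutation relation between d/dz_i and multiplication by z_j.\<close>

lemma zderiv_zmult:
  "zderiv i (zmult j P) = (\<lambda>\<alpha>. zmult j (zderiv i P) \<alpha> + (if i = j then P \<alpha> else 0))"
proof (cases "i = j")
  case True
  have "zderiv j (zmult j P) \<alpha> = zmult j (zderiv j P) \<alpha> + P \<alpha>" for \<alpha>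
    by (cases "\<alpha> j")
       (auto simp: zderiv_def zmult_def algebra_simps fun_upd_idem[of \<alpha> j, THEN arg_cong[of _ _ P]])
  thus ?thesis using True by (simp add: fun_eq_iff)
next
  case False
  thus ?thesis by (auto simp: zderiv_def zmult_def fun_eq_iff fun_upd_twist)
qed

text \<open>Commuting d/dz_i past each z_j leaves one extra term per k. Thus the gradient of an
  eigenvector satisfies a system governed by the transpose of A.\<close>

lemma zderiv_linear_field:
  "zderiv i (linear_field A P)
    = (\<lambda>\<alpha>. linear_field A (zderiv i P) \<alpha> + (\<Sum>k\<in>UNIV. A $ k $ i * zderiv k P \<alpha>))"
proof
  fix \<alpha>
  have "zderiv i (linear_field A P) \<alpha>
      = (\<Sum>k\<in>UNIV. \<Sum>j\<in>UNIV. A $ k $ j * zderiv i (zmult j (zderiv k P)) \<alpha>)"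
    by (simp add: zderiv_def[of i] linear_field_def sum_distrib_left algebra_simps)
  also have "\<dots> = (\<Sum>k\<in>UNIV. \<Sum>j\<in>UNIV. A $ k $ j * zmult j (zderiv k (zderiv i P)) \<alpha>
      + (if i = j then A $ k $ j * zderiv k P \<alpha> else 0))"
    by (intro sum.cong refl) (simp add: zderiv_zmult zderiv_commute[of i] distrib_left)
  also have "\<dots> = linear_field A (zderiv i P) \<alpha> + (\<Sum>k\<in>UNIV. A $ k $ i * zderiv k P \<alpha>)"
    by (simp add: sum.distrib linear_field_def)
  finally show "zderiv i (linear_field A P) \<alpha>
    = linear_field A (zderiv i P) \<alpha> + (\<Sum>k\<in>UNIV. A $ k $ i * zderiv k P \<alpha>)" .
qed

section \<open>Absence of eigenvectors in nonresonant degrees\<close>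

text \<open>The characteristic matrix at t is minus the transpose of \<open>mat (l - t) - A\<close>;
  the n signs are absorbed by the n linear factors.\<close>

lemma eigenvalue_family_reflect:
  fixes A :: "complex^'n^'n"
  assumes "eigenvalue_family A \<mu>"
  shows "eigenvalue_family (mat l - transpose A) (\<lambda>i. l - \<mu> i)"
  unfolding eigenvalue_family_def
proof
  fix t
  have "mat t - (mat l - transpose A) = (\<chi> i. (-1) *s ((transpose (mat (l - t) - A)) $ i))"
    by (auto simp: vec_eq_iff mat_def transpose_def)
  hence "det (mat t - (mat l - transpose A)) = (-1) ^ CARD('n) * det (transpose (mat (l - t) - A))"
    by (simp only: det_rows_mul) simp
  also have "\<dots> = (-1) ^ CARD('n) * (\<Prod>i\<in>UNIV. (l - t) - \<mu> i)"
    using assms by (simp only: det_transpose) (simp add: eigenvalue_family_def)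
  also have "\<dots> = (\<Prod>i\<in>UNIV. t - (l - \<mu> i))"
    by (simp add: prod.distrib[symmetric] algebra_simps flip: prod_constant)
  finally show "det (mat t - (mat l - transpose A)) = (\<Prod>i\<in>UNIV. t - (l - \<mu> i))" .
qed

lemma eigenvalue_family_shift:
  assumes "eigenvalue_family A \<mu>"
  shows "eigenvalue_family (A + mat q) (\<lambda>i. \<mu> i + q)"
  unfolding eigenvalue_family_def
proof
  fix t
  have "mat t - (A + mat q) = mat (t - q) - A" by (auto simp: vec_eq_iff mat_def)
  thus "det (mat t - (A + mat q)) = (\<Prod>i\<in>UNIV. t - (\<mu> i + q))"
    using assms by (simp add: eigenvalue_family_def algebra_simps)
qed

text \<open>The gradient of an eigenvector of degree \<open>m\<close> is a solution of degree \<open>m - 1\<close> of a matrix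
  eigenvalue problem for \<open>l - A\<^sup>T\<close>.\<close>

lemma linear_field_eigenvector_trivial:
  fixes A :: "complex^'n^'n"
  assumes \<mu>: "eigenvalue_family A \<mu>"
    and "P \<in> homogeneous m" "linear_field A P = (\<lambda>\<alpha>. l * P \<alpha>)"
    and "\<And>p :: 'n \<Rightarrow> nat. sum p UNIV = m \<Longrightarrow> (\<Sum>i\<in>UNIV. of_nat (p i) * \<mu> i) \<noteq> l"
  shows "P = (\<lambda>_. 0)"
  using assms(2-)
proof (induction m arbitrary: P l)
  case 0
  \<comment> \<open>The zero exponent has degree 0 and gives the sum 0, while the linear field kills
    constants.\<close>
  have "l \<noteq> 0" using "0.prems"(3)[of "\<lambda>_. 0"] by simp
  moreover have "linear_field A P = (\<lambda>_. 0)"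
    by (simp add: linear_field_def zderiv_homogeneous_0[OF "0.prems"(1)] zmult_def)
  ultimately show ?case using "0.prems"(2) by (simp add: fun_eq_iff)
next
  case (Suc m)
  interpret linear_operator "linear_field A" by (rule linear_operator_linear_field)
  have grad: "zderiv k P = (\<lambda>_. 0)" for k
  proof (rule matrix_eigen_system_trivial[where S = "homogeneous m"
        and M = "mat l - transpose A" and \<mu> = "\<lambda>i. l - \<mu> i" and G = "\<lambda>k. zderiv k P"])
    show "eigenvalue_family (mat l - transpose A) (\<lambda>i. l - \<mu> i)"
      using \<mu> by (rule eigenvalue_family_reflect)
    show "zderiv i P \<in> homogeneous m" for i
      using Suc.prems(1) by (rule zderiv_homogeneous)
    show "(\<lambda>a. linear_field A f a - c * f a) \<in> homogeneous m" if "f \<in> homogeneous m" for f c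
      using that linear_field_homogeneous[OF that, of A] by (simp add: homogeneous_def)
    show "f = (\<lambda>_. 0)" if f: "f \<in> homogeneous m" "linear_field A f = (\<lambda>a. (l - \<mu> j) * f a)" for f j
    proof (rule Suc.IH[OF f])
      fix p :: "'n \<Rightarrow> nat" assume p: "sum p UNIV = m"
      show "(\<Sum>i\<in>UNIV. of_nat (p i) * \<mu> i) \<noteq> l - \<mu> j"
        \<comment> \<open>Raising p by one at j adds \<open>\<mu> j\<close> to the sum, so equality
          here would contradict the hypothesis in degree \<open>Suc m\<close>.\<close>
        using Suc.prems(3)[of "p(j := Suc (p j))"] p
        by (simp add: sum_fun_upd_Suc sum.remove[of UNIV j] algebra_simps)
    qed
    show "linear_field A (zderiv i P)
        = (\<lambda>a. \<Sum>j\<in>UNIV. (mat l - transpose A) $ i $ j * zderiv j P a)" for i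
    proof
      fix a
      have "linear_field A (zderiv i P) a
          = zderiv i (linear_field A P) a - (\<Sum>k\<in>UNIV. A $ k $ i * zderiv k P a)"
        by (simp add: zderiv_linear_field)
      also have "zderiv i (linear_field A P) a = l * zderiv i P a"
        by (simp add: Suc.prems(2) zderiv_def)
      also have "l * zderiv i P a - (\<Sum>k\<in>UNIV. A $ k $ i * zderiv k P a)
          = (\<Sum>j\<in>UNIV. (mat l - transpose A) $ i $ j * zderiv j P a)"
        by (simp add: mat_def transpose_def left_diff_distrib sum_subtractf if_distrib[of "\<lambda>x. x * _"]
            cong: if_cong)
      finally show "linear_field A (zderiv i P) a
        = (\<Sum>j\<in>UNIV. (mat l - transpose A) $ i $ j * zderiv j P a)" .
    qed
  qed
  show ?case
  proof
    fix \<alpha>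
    show "P \<alpha> = 0"
    proof (cases "sum \<alpha> UNIV = Suc m")
      case True
      \<comment> \<open>A multi-index of positive degree has a positive entry, so its coefficient is
        recovered from a partial derivative.\<close>
      then obtain i where i: "\<alpha> i \<noteq> 0" by (metis Zero_not_Suc sum.neutral)
      have "zderiv i P (\<alpha>(i := \<alpha> i - 1)) = of_nat (\<alpha> i) * P \<alpha>"
        using i by (simp add: zderiv_def)
      thus ?thesis using i grad by simp
    qed (use Suc.prems(1) in \<open>simp add: homogeneous_def\<close>)
  qed
qed

text \<open>In terms of \<open>P = (P\<^sub>i)\<close>, the hypothesis says that \<open>[Az \<partial>\<^sub>z, P \<partial>\<^sub>z] = q P \<partial>\<^sub>z\<close>.\<close>

lemma nonresonant_homogeneous_trivial:
  fixes A :: "complex^'n^'n"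
  assumes \<mu>: "eigenvalue_family A \<mu>" and res: "no_transverse_negative_resonance \<mu>"
    and "m \<ge> 1" "q \<ge> (1::nat)"
    and P: "\<And>i. P i \<in> homogeneous m"
    and eq: "\<And>i. linear_field A (P i) = (\<lambda>\<alpha>. (\<Sum>j\<in>UNIV. A $ i $ j * P j \<alpha>) + of_nat q * P i \<alpha>)"
  shows "P k = (\<lambda>_. 0)"
proof -
  interpret linear_operator "linear_field A" by (rule linear_operator_linear_field)
  show ?thesis
  proof (rule matrix_eigen_system_trivial[where S = "homogeneous m"
        and M = "A + mat (of_nat q)" and \<mu> = "\<lambda>i. \<mu> i + of_nat q" and G = P])
    show "(\<lambda>a. linear_field A f a - c * f a) \<in> homogeneous m" if "f \<in> homogeneous m" for f c
      using that linear_field_homogeneous[OF that, of A] by (simp add: homogeneous_def)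
    show "f = (\<lambda>_. 0)" if f: "f \<in> homogeneous m" "linear_field A f = (\<lambda>a. (\<mu> j + of_nat q) * f a)" for f j
    \<comment> \<open>The excluded equality is a resonance whose exponent p has degree
      \<open>m \<ge> 1\<close>.\<close>
    proof (rule linear_field_eigenvector_trivial[OF \<mu> f])
      show "(\<Sum>i\<in>UNIV. of_nat (p i) * \<mu> i) \<noteq> \<mu> j + of_nat q" if "sum p UNIV = m" for p :: "'n \<Rightarrow> nat"
        using res that \<open>m \<ge> 1\<close> \<open>q \<ge> 1\<close> unfolding no_transverse_negative_resonance_def by blast
    qed
    show "eigenvalue_family (A + mat (of_nat q)) (\<lambda>i. \<mu> i + of_nat q)"
      by (rule eigenvalue_family_shift[OF \<mu>])
    show "linear_field A (P i) = (\<lambda>a. \<Sum>j\<in>UNIV. (A + mat (of_nat q)) $ i $ j * P j a)" for i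
      by (simp add: eq mat_def distrib_right sum.distrib if_distrib[of "\<lambda>x. x * _"] cong: if_cong)
  qed (rule P)
qed

section \<open>Laurent coefficients on an annulus\<close>

lemma open_annulus: "open (annulus r R)"
proof -
  have "annulus r R = {x. r < cmod x} \<inter> {x. cmod x < R}" by (auto simp: annulus_def)
  thus ?thesis by (auto intro!: open_Int open_Collect_less continuous_intros)
qed

lemma sphere_subset_annulus: "r < s \<Longrightarrow> s < R \<Longrightarrow> sphere 0 s \<subseteq> annulus r R"
  by (auto simp: annulus_def)

lemma contour_integrable_annulus:
  assumes "f holomorphic_on annulus r R" "0 \<le> r" "r < s" "s < R"
  shows "f contour_integrable_on circlepath 0 s"
proof -
  have "sphere 0 s \<subseteq> annulus r R" using assms by (intro sphere_subset_annulus)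
  thus ?thesis using assms
    by (intro contour_integrable_continuous_circlepath holomorphic_on_imp_continuous_on)
       (auto intro: holomorphic_on_subset)
qed

text \<open>The segments joining points of equal argument on the two circles stay in the annulus,
  which gives a homotopy of loops.\<close>

lemma contour_integral_annulus_radius_indep:
  assumes f: "f holomorphic_on annulus r R" and r: "0 \<le> r" and s: "r < s" "s < R" and t: "r < t" "t < R"
  shows "contour_integral (circlepath 0 s) f = contour_integral (circlepath 0 t) f"
proof (rule Cauchy_theorem_homotopic_loops[OF _ open_annulus f])
  show "homotopic_loops (annulus r R) (circlepath 0 s) (circlepath 0 t)"
  proof (rule homotopic_loops_linear)
    fix u :: real
    show "closed_segment (circlepath 0 s u) (circlepath 0 t u) \<subseteq> annulus r R"
    proof
      fix x assume "x \<in> closed_segment (circlepath 0 s u) (circlepath 0 t u)"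
      then obtain v where v: "0 \<le> v" "v \<le> 1"
        and x: "x = (1 - v) *\<^sub>R circlepath 0 s u + v *\<^sub>R circlepath 0 t u"
        by (auto simp: closed_segment_def)
      define \<rho> where "\<rho> = (1 - v) * s + v * t"
      have "\<rho> \<in> closed_segment s t" using v by (auto simp: closed_segment_def \<rho>_def)
      hence \<rho>: "r < \<rho>" "\<rho> < R" using s t by (auto simp: closed_segment_eq_real_ivl split: if_splits)
      have "x = of_real \<rho> * exp (2 * of_real pi * \<i> * of_real u)"
        by (simp add: x circlepath \<rho>_def scaleR_conv_of_real algebra_simps)
      hence "cmod x = \<rho>" using \<rho> r by (simp add: norm_mult)
      thus "x \<in> annulus r R" using \<rho> by (simp add: annulus_def)
    qed
  qed (auto intro: valid_path_imp_path)
qed auto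

text \<open>Expand \<open>1 / (w - z)\<close> in powers of \<open>w / z\<close>.\<close>

lemma Cauchy_transform_eq_0_outside:
  assumes f: "continuous_on (sphere 0 s) f" and s: "0 < s" "s < cmod z"
    and mom: "\<And>k::nat. contour_integral (circlepath 0 s) (\<lambda>w. f w * w ^ k) = 0"
  shows "contour_integral (circlepath 0 s) (\<lambda>w. f w / (w - z)) = 0"
proof -
  let ?I = "contour_integral (circlepath 0 s)"
  have z: "z \<noteq> 0" and wz: "\<And>w. cmod w = s \<Longrightarrow> w \<noteq> z" using s by auto
  have int: "(\<lambda>w. f w * w ^ k) contour_integrable_on circlepath 0 s" for k
    using f s by (intro contour_integrable_continuous_circlepath continuous_intros) auto
  have eq: "?I (\<lambda>w. f w / (w - z)) = ?I (\<lambda>w. f w * w ^ N / (w - z)) / z ^ N"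
    and intz: "(\<lambda>w. f w * w ^ N / (w - z)) contour_integrable_on circlepath 0 s" for N
  proof -
    show intz: "(\<lambda>w. f w * w ^ N / (w - z)) contour_integrable_on circlepath 0 s" for N
      using f s wz by (intro contour_integrable_continuous_circlepath continuous_intros) auto
    show "?I (\<lambda>w. f w / (w - z)) = ?I (\<lambda>w. f w * w ^ N / (w - z)) / z ^ N"
    proof (induction N)
      case (Suc N)
      \<comment> \<open>From w / (w - z) = 1 + z / (w - z): the first summand contributes a
        vanishing moment.\<close>
      have "?I (\<lambda>w. f w * w ^ Suc N / (w - z)) = ?I (\<lambda>w. f w * w ^ N + z * (f w * w ^ N / (w - z)))"
      proof (rule contour_integral_cong[OF refl])
        fix w assume "w \<in> path_image (circlepath 0 s)"
        hence "w \<noteq> z" using wz s by auto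
        thus "f w * w ^ Suc N / (w - z) = f w * w ^ N + z * (f w * w ^ N / (w - z))"
          by (simp add: field_simps)
      qed
      also have "\<dots> = z * ?I (\<lambda>w. f w * w ^ N / (w - z))"
        using int intz by (simp add: contour_integral_add contour_integrable_lmul contour_integral_lmul mom
            del: times_divide_eq_right)
      finally show ?case using Suc z by simp
    qed simp
  qed
  obtain B where B: "0 \<le> B" "\<And>w. cmod w = s \<Longrightarrow> cmod (f w / (w - z)) \<le> B"
  proof -
    have "compact ((\<lambda>w. f w / (w - z)) ` sphere 0 s)"
      using f wz by (intro compact_continuous_image continuous_intros compact_sphere) auto
    then obtain B where "\<forall>x\<in>(\<lambda>w. f w / (w - z)) ` sphere 0 s. cmod x \<le> B"
      using compact_imp_bounded bounded_iff by blast
    thus ?thesis by (intro that[of "max 0 B"]) (auto simp: le_max_iff_disj)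
  qed
  have bound: "cmod (?I (\<lambda>w. f w / (w - z))) \<le> B * (2 * pi * s) * (s / cmod z) ^ N" for N
  proof -
    have "cmod (?I (\<lambda>w. f w * w ^ N / (w - z))) \<le> (B * s ^ N) * (2 * pi * s)"
    proof (rule has_contour_integral_bound_circlepath[OF has_contour_integral_integral[OF intz]])
      fix w assume "cmod (w - 0) = s"
      hence w: "cmod w = s" by simp
      have "cmod (f w * w ^ N / (w - z)) = cmod (f w / (w - z)) * s ^ N"
        using w by (simp add: norm_mult norm_divide norm_power)
      also have "\<dots> \<le> B * s ^ N" using B(2)[OF w] s by (intro mult_right_mono) auto
      finally show "cmod (f w * w ^ N / (w - z)) \<le> B * s ^ N" .
    qed (use B s in auto)
    hence "cmod (?I (\<lambda>w. f w * w ^ N / (w - z)) / z ^ N) \<le> (B * s ^ N) * (2 * pi * s) / cmod z ^ N"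
      by (simp add: norm_divide norm_power divide_right_mono)
    thus ?thesis by (simp add: eq[of N, symmetric] power_divide mult_ac)
  qed
  \<comment> \<open>The bound holds for every N and its ratio s / |z| is below 1.\<close>
  have "(\<lambda>N. B * (2 * pi * s) * (s / cmod z) ^ N) \<longlonglongrightarrow> B * (2 * pi * s) * 0"
    using s by (intro tendsto_mult tendsto_const LIMSEQ_power_zero) (auto simp: divide_less_eq)
  hence "cmod (?I (\<lambda>w. f w / (w - z))) \<le> B * (2 * pi * s) * 0"
    by (rule LIMSEQ_le_const) (use bound in auto)
  thus ?thesis by simp
qed

text \<open>The difference quotient g of f at z is holomorphic across z, so its integrals over both
  circles agree. The remaining term f(z) / (w - z) integrates to 2 pi i f(z) over the outer circle,
  which encloses z, and to 0 over the inner one.\<close>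

lemma Cauchy_integral_annulus:
  assumes f: "f holomorphic_on annulus r R" and r: "0 \<le> r"
    and rad: "r < s" "s < cmod z" "cmod z < t" "t < R"
  shows "contour_integral (circlepath 0 t) (\<lambda>w. f w / (w - z))
    - contour_integral (circlepath 0 s) (\<lambda>w. f w / (w - z)) = 2 * of_real pi * \<i> * f z"
proof -
  define g where "g = (\<lambda>w. if w = z then deriv f z else f w / (w - z) - f z / (w - z))"
  have g: "g holomorphic_on annulus r R"
    unfolding g_def
    by (rule pole_theorem_open[OF f open_annulus]) auto
  have fcont: "continuous_on (annulus r R) f" using f by (rule holomorphic_on_imp_continuous_on)
  have int: "(\<lambda>w. f w / (w - z)) contour_integrable_on circlepath 0 u"
      "(\<lambda>w. f z / (w - z)) contour_integrable_on circlepath 0 u"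
    if "r < u" "u < R" "u \<noteq> cmod z" for u
    using that r sphere_subset_annulus[of r u R]
    by (auto intro!: contour_integrable_continuous_circlepath continuous_intros
        continuous_on_subset[OF fcont])
  have split: "contour_integral (circlepath 0 u) g
      = contour_integral (circlepath 0 u) (\<lambda>w. f w / (w - z)) - contour_integral (circlepath 0 u) (\<lambda>w. f z / (w - z))"
    if "r < u" "u < R" "u \<noteq> cmod z" for u
  proof -
    have "contour_integral (circlepath 0 u) g = contour_integral (circlepath 0 u) (\<lambda>w. f w / (w - z) - f z / (w - z))"
      using that r by (intro contour_integral_cong) (auto simp: g_def)
    thus ?thesis using int[OF that] by (simp add: contour_integral_diff)
  qed
  have "contour_integral (circlepath 0 t) (\<lambda>w. f z / (w - z)) = 2 * of_real pi * \<i> * f z"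
    using rad by (intro contour_integral_unique Cauchy_integral_circlepath_simple) auto
  moreover have "((\<lambda>w. f z / (w - z)) has_contour_integral 0) (circlepath 0 s)"
    using rad r by (intro Cauchy_theorem_disc_simple[of _ 0 "cmod z"] holomorphic_intros) auto
  moreover have "contour_integral (circlepath 0 s) g = contour_integral (circlepath 0 t) g"
    using rad by (intro contour_integral_annulus_radius_indep[OF g r]) auto
  ultimately show ?thesis
    using split[of s] split[of t] rad by (simp add: contour_integral_unique algebra_simps)
qed

text \<open>The moment of order k is, up to 2 pi i, the Laurent coefficient at index -(k + 1). When
  all of these vanish, the inner Cauchy integral is 0 and f is given by the outer one, which is
  holomorphic on the whole inner disc.\<close>

lemma holomorphic_extension_annulus:
  assumes f: "f holomorphic_on annulus r R" and r: "0 \<le> r" "r < R"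
    and mom: "\<And>s (k::nat). r < s \<Longrightarrow> s < R \<Longrightarrow> contour_integral (circlepath 0 s) (\<lambda>w. f w * w ^ k) = 0"
  obtains h where "h holomorphic_on ball 0 R" "\<And>x. x \<in> annulus r R \<Longrightarrow> h x = f x"
proof -
  obtain t where t: "r < t" "t < R" using r dense by blast
  define F where "F = (\<lambda>z. contour_integral (circlepath 0 t) (\<lambda>w. f w / (w - z)) / (2 * of_real pi * \<i>))"
  have fcont: "continuous_on (sphere 0 u) f" if "r < u" "u < R" for u
    using f sphere_subset_annulus[OF that] continuous_on_subset holomorphic_on_imp_continuous_on by blast
  have F: "F holomorphic_on ball 0 t"
  proof -
    have "(\<lambda>z. contour_integral (circlepath 0 t) (\<lambda>w. f w / (w - z))) holomorphic_on ball 0 t"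
    proof (subst holomorphic_on_open[OF open_ball], intro ballI exI)
      fix z :: complex assume z: "z \<in> ball 0 t"
      show "((\<lambda>z. contour_integral (circlepath 0 t) (\<lambda>w. f w / (w - z))) has_field_derivative
          of_nat 1 * contour_integral (circlepath 0 t) (\<lambda>w. f w / (w - z) ^ Suc 1)) (at z)"
      proof (rule Cauchy_next_derivative_circlepath(2)[OF _ _ _ z])
        show "continuous_on (path_image (circlepath 0 t)) f" using fcont t r by simp
        fix w :: complex assume "w \<in> ball 0 t"
        hence "(\<lambda>u. f u / (u - w) ^ 1) contour_integrable_on circlepath 0 t"
          using fcont t r by (intro contour_integrable_continuous_circlepath continuous_intros) auto
        thus "((\<lambda>u. f u / (u - w) ^ 1) has_contour_integral
            contour_integral (circlepath 0 t) (\<lambda>u. f u / (u - w))) (circlepath 0 t)"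
          by (simp add: has_contour_integral_integral)
      qed simp
    qed
    thus ?thesis unfolding F_def by (intro holomorphic_intros) auto
  qed
  have Ff: "F z = f z" if z: "z \<in> annulus r R" "z \<in> ball 0 t" for z
  proof -
    obtain s where s: "r < s" "s < cmod z" using z dense by (auto simp: annulus_def)
    have "contour_integral (circlepath 0 s) (\<lambda>w. f w / (w - z)) = 0"
      using s r z t fcont[of s] mom[of s] by (intro Cauchy_transform_eq_0_outside) auto
    hence "contour_integral (circlepath 0 t) (\<lambda>w. f w / (w - z)) = 2 * of_real pi * \<i> * f z"
      using Cauchy_integral_annulus[OF f r(1) s, of t] z t by simp
    thus ?thesis by (simp add: F_def)
  qed
  \<comment> \<open>F covers only the disc of radius t < R; f itself supplies the rest, and the two
    agree on the overlap.\<close>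
  have "annulus r R \<union> ball 0 t = ball 0 R"
    using t by (auto simp: annulus_def)
  hence "(\<lambda>z. if z \<in> annulus r R then f z else F z) holomorphic_on ball 0 R"
    using holomorphic_on_If_Un[OF f F open_annulus open_ball] Ff by simp
  thus ?thesis by (rule that) auto
qed

text \<open>The function f(x) x^q is a primitive of the difference of both sides. In Laurent terms,
  x d/dx multiplies the coefficient at index -q by -q.\<close>

lemma contour_integral_Euler_by_parts:
  assumes f: "f holomorphic_on annulus r R" and r: "0 \<le> r" "r < s" "s < R" and "q \<ge> 1"
  shows "contour_integral (circlepath 0 s) (\<lambda>x. x * deriv f x * x ^ (q - 1))
    = - of_nat q * contour_integral (circlepath 0 s) (\<lambda>x. f x * x ^ (q - 1))"
proof -
  have df: "deriv f holomorphic_on annulus r R" using f open_annulus by (rule holomorphic_deriv)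
  have "((\<lambda>x. x * deriv f x * x ^ (q - 1) + of_nat q * (f x * x ^ (q - 1))) has_contour_integral 0)
      (circlepath 0 s)"
  proof (rule Cauchy_theorem_primitive)
    fix x assume x: "x \<in> annulus r R"
    have "(f has_field_derivative deriv f x) (at x)"
      using f open_annulus x by (rule holomorphic_derivI)
    hence "((\<lambda>x. f x * x ^ q) has_field_derivative
        deriv f x * x ^ q + of_nat q * x ^ (q - 1) * f x) (at x)"
      by (auto intro!: derivative_eq_intros)
    moreover have "x ^ q = x * x ^ (q - 1)" using \<open>q \<ge> 1\<close> by (cases q) auto
    ultimately show "((\<lambda>x. f x * x ^ q) has_field_derivative
        x * deriv f x * x ^ (q - 1) + of_nat q * (f x * x ^ (q - 1))) (at x within annulus r R)"
      by (auto simp: algebra_simps intro: has_field_derivative_at_within)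
  qed (use r sphere_subset_annulus[of r s R] in auto)
  hence "contour_integral (circlepath 0 s) (\<lambda>x. x * deriv f x * x ^ (q - 1) + of_nat q * (f x * x ^ (q - 1))) = 0"
    by (rule contour_integral_unique)
  moreover have "(\<lambda>x. x * deriv f x * x ^ (q - 1)) contour_integrable_on circlepath 0 s"
      "(\<lambda>x. f x * x ^ (q - 1)) contour_integrable_on circlepath 0 s"
    using df f r by (auto intro!: contour_integrable_annulus[of _ r R] holomorphic_intros)
  ultimately show ?thesis
    by (simp add: contour_integral_add contour_integral_lmul contour_integrable_lmul eq_neg_iff_add_eq_0)
qed

section \<open>Pointwise form of normalized vector fields\<close>

text \<open>The product of \<open>tf_ring\<close> at one fixed x.\<close>

definition conv :: "(('n::finite \<Rightarrow> nat) \<Rightarrow> complex) \<Rightarrow> (('n \<Rightarrow> nat) \<Rightarrow> complex) \<Rightarrow> ('n \<Rightarrow> nat) \<Rightarrow> complex" where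
  "conv P Q \<alpha> = (\<Sum>(\<beta>, \<gamma>)\<in>{(\<beta>, \<gamma>). (\<lambda>i. \<beta> i + \<gamma> i) = \<alpha>}. P \<beta> * Q \<gamma>)"

definition monomial :: "('n \<Rightarrow> nat) \<Rightarrow> ('n \<Rightarrow> nat) \<Rightarrow> complex" where
  "monomial \<gamma> = (\<lambda>\<alpha>. if \<alpha> = \<gamma> then 1 else 0)"

lemma conv_add_right: "conv P (\<lambda>\<alpha>. Q \<alpha> + Q' \<alpha>) \<alpha> = conv P Q \<alpha> + conv P Q' \<alpha>"
  by (simp add: conv_def case_prod_unfold distrib_left sum.distrib)

lemma conv_scale_right: "conv P (\<lambda>\<alpha>. c * Q \<alpha>) \<alpha> = c * conv P Q \<alpha>"
  by (simp add: conv_def case_prod_unfold sum_distrib_left mult_ac)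

lemma conv_commute: "conv P Q \<alpha> = conv Q P \<alpha>"
  unfolding conv_def
  by (rule sum.reindex_bij_witness[of _ prod.swap prod.swap]) (auto simp: mult.commute add.commute)

lemma conv_const_left: "conv (\<lambda>\<alpha>. if \<alpha> = (\<lambda>_. 0) then c else 0) Q \<alpha> = c * Q \<alpha>"
proof -
  have "conv (\<lambda>\<alpha>. if \<alpha> = (\<lambda>_. 0) then c else 0) Q \<alpha>
      = (\<Sum>p\<in>{(\<beta>, \<gamma>). (\<lambda>i. \<beta> i + \<gamma> i) = \<alpha>}. if p = ((\<lambda>_. 0), \<alpha>) then c * Q \<alpha> else 0)"
    unfolding conv_def by (intro sum.cong) (auto split: if_splits)
  also have "\<dots> = c * Q \<alpha>"
    by (subst sum.delta[OF finite_multi_index_sums]) auto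
  finally show ?thesis .
qed

lemma conv_monomial_0_right: "conv P (monomial (\<lambda>_. 0)) \<alpha> = P \<alpha>"
  using conv_const_left[of 1 P \<alpha>] by (simp add: conv_commute[of P] monomial_def)

text \<open>At most one splitting of \<alpha> has the unit multi-index of j as first part, and it
  exists exactly when \<open>\<alpha> j \<noteq> 0\<close>.\<close>

lemma conv_var_left: "conv (monomial ((\<lambda>_. 0)(j := 1))) Q \<alpha> = zmult j Q \<alpha>"
proof -
  let ?e = "(\<lambda>_. 0)(j := Suc 0)" and ?S = "{(\<beta>, \<gamma>). (\<lambda>i. \<beta> i + \<gamma> i) = \<alpha>}"
  have eq0: "(\<lambda>i. ?e i + \<gamma> i) = \<alpha> \<longleftrightarrow> \<alpha> j \<noteq> 0 \<and> \<gamma> = \<alpha>(j := \<alpha> j - 1)" for \<gamma>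
  proof
    assume "(\<lambda>i. ?e i + \<gamma> i) = \<alpha>"
    hence "\<alpha> i = ?e i + \<gamma> i" for i by (rule fun_cong[symmetric])
    thus "\<alpha> j \<noteq> 0 \<and> \<gamma> = \<alpha>(j := \<alpha> j - 1)" by (auto simp: fun_eq_iff)
  qed (auto simp: fun_eq_iff)
  have eq: "\<beta> = ?e \<and> (\<lambda>i. \<beta> i + \<gamma> i) = \<alpha> \<longleftrightarrow> \<alpha> j \<noteq> 0 \<and> \<beta> = ?e \<and> \<gamma> = \<alpha>(j := \<alpha> j - 1)" for \<beta> \<gamma>
    using eq0[of \<gamma>] by blast
  have "conv (monomial ?e) Q \<alpha>
      = (\<Sum>p\<in>?S. if p = (?e, \<alpha>(j := \<alpha> j - 1)) then Q (\<alpha>(j := \<alpha> j - 1)) else 0)"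
    unfolding conv_def monomial_def
  proof (intro sum.cong refl)
    fix p assume "p \<in> ?S"
    then obtain \<beta> \<gamma> where p: "p = (\<beta>, \<gamma>)" and \<alpha>: "(\<lambda>i. \<beta> i + \<gamma> i) = \<alpha>" by blast
    show "(case p of (\<beta>, \<gamma>) \<Rightarrow> (if \<beta> = ?e then 1 else 0) * Q \<gamma>)
        = (if p = (?e, \<alpha>(j := \<alpha> j - 1)) then Q (\<alpha>(j := \<alpha> j - 1)) else 0)"
      using eq[of \<beta> \<gamma>] unfolding p \<alpha> by (cases "\<beta> = ?e") auto
  qed
  also have "\<dots> = zmult j Q \<alpha>"
    using eq[of ?e "\<alpha>(j := \<alpha> j - 1)"]
    by (subst sum.delta[OF finite_multi_index_sums]) (auto simp: zmult_def)
  finally show ?thesis by simp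
qed

lemma tf_mult_apply: "(f \<otimes>\<^bsub>tf_ring U\<^esub> g) \<alpha> x = conv (\<lambda>\<beta>. f \<beta> x) (\<lambda>\<gamma>. g \<gamma> x) \<alpha>"
  by (simp add: tf_ring_simps conv_def)

lemma tf_finsum_apply:
  fixes F :: "'i \<Rightarrow> ('n::finite) tf_series"
  assumes "finite I" "\<And>i. i \<in> I \<Longrightarrow> F i \<in> carrier (tf_ring U)"
  shows "(\<Oplus>\<^bsub>tf_ring U\<^esub>i\<in>I. F i) \<alpha> x = (\<Sum>i\<in>I. F i \<alpha> x)"
proof -
  interpret cring "tf_ring U :: 'n tf_series ring" by (rule cring_tf_ring)
  show ?thesis using assms
  proof (induction I)
    case empty
    have "(\<Oplus>\<^bsub>tf_ring U\<^esub>i\<in>{}. F i) = \<zero>\<^bsub>tf_ring U\<^esub>" by (rule finsum_empty)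
    thus ?case by (simp add: tf_ring_simps(4))
  next
    case (insert i I)
    hence "(\<Oplus>\<^bsub>tf_ring U\<^esub>i\<in>insert i I. F i) = F i \<oplus>\<^bsub>tf_ring U\<^esub> (\<Oplus>\<^bsub>tf_ring U\<^esub>i\<in>I. F i)"
      by (intro finsum_insert) auto
    with insert show ?case by (simp add: tf_ring_simps(5))
  qed
qed

lemma tf_coeff_closed: "g holomorphic_on U \<Longrightarrow> tf_coeff U g \<in> carrier (tf_ring U)"
proof -
  assume g: "g holomorphic_on U"
  have "tf_coeff U g \<alpha> holomorphic_on U" for \<alpha> :: "'a \<Rightarrow> nat"
    by (rule holomorphic_transform[of "\<lambda>x. if \<alpha> = (\<lambda>_. 0) then g x else 0"])
       (use g in \<open>cases "\<alpha> = (\<lambda>_. 0)"; simp add: tf_coeff_def\<close>)+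
  thus ?thesis by (simp add: tf_ring_simps) (simp add: tf_coeff_def)
qed

lemma tf_var_closed: "tf_var U i \<in> carrier (tf_ring U)"
proof -
  have "tf_var U i \<alpha> holomorphic_on U" for \<alpha>
    by (rule holomorphic_transform[of "\<lambda>x. if \<alpha> = (\<lambda>_. 0)(i := 1) then 1 else 0"])
       (auto simp: tf_var_def)
  thus ?thesis by (simp add: tf_ring_simps) (simp add: tf_var_def)
qed

lemma tf_dz_closed: "f \<in> carrier (tf_ring U) \<Longrightarrow> tf_dz i f \<in> carrier (tf_ring U)"
  by (auto simp: tf_ring_simps tf_dz_def intro!: holomorphic_intros)

lemma tf_restrict_closed:
  assumes "V \<subseteq> U" "f \<in> carrier (tf_ring U)" shows "tf_restrict V f \<in> carrier (tf_ring V)"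
proof -
  have "tf_restrict V f \<alpha> holomorphic_on V" for \<alpha>
    by (rule holomorphic_transform[of "f \<alpha>"])
       (use assms in \<open>auto simp: tf_restrict_def tf_ring_simps intro: holomorphic_on_subset\<close>)
  thus ?thesis by (simp add: tf_ring_simps) (simp add: tf_restrict_def)
qed

lemma tf_var_apply: "x \<in> U \<Longrightarrow> tf_var U j \<alpha> x = monomial ((\<lambda>_. 0)(j := 1)) \<alpha>"
  by (simp add: tf_var_def monomial_def)

text \<open>Evaluation at x reduces the ring expression to operators on coefficient functions; only
  \<open>deriv\<close> still looks at neighbouring points.\<close>

lemma x_normal_form_apply:
  fixes f :: "('n::finite) tf_series"
  assumes "open U" "x \<in> U" and f: "f \<in> carrier (tf_ring U)" and b: "\<And>i. b i \<in> carrier (tf_ring U)"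
  shows "x_normal_form U A b f \<alpha> x = x * deriv (f \<alpha>) x + linear_field A (\<lambda>\<alpha>. f \<alpha> x) \<alpha>
    + (\<Sum>i\<in>UNIV. conv (\<lambda>\<alpha>. b i \<alpha> x) (zderiv i (\<lambda>\<alpha>. f \<alpha> x)) \<alpha>)"
proof -
  interpret cring "tf_ring U :: 'n tf_series ring" by (rule cring_tf_ring)
  have coeff: "conv (\<lambda>\<beta>. tf_coeff U g \<beta> x) Q \<gamma> = g x * Q \<gamma>" for g Q and \<gamma> :: "'n \<Rightarrow> nat"
    using conv_const_left[of "g x" Q \<gamma>] \<open>x \<in> U\<close> by (simp add: tf_coeff_def cong: if_cong)
  have dz: "(\<lambda>\<gamma>. tf_dz i f \<gamma> x) = zderiv i (\<lambda>\<alpha>. f \<alpha> x)" for i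
    by (simp add: tf_dz_def zderiv_def)
  have closed: "tf_coeff U (\<lambda>_. c) \<otimes>\<^bsub>tf_ring U\<^esub> tf_var U j \<otimes>\<^bsub>tf_ring U\<^esub> tf_dz i f \<in> carrier (tf_ring U)"
    "b i \<otimes>\<^bsub>tf_ring U\<^esub> tf_dz i f \<in> carrier (tf_ring U)" for c i j
    using f b by (auto intro!: m_closed tf_coeff_closed tf_var_closed tf_dz_closed)
  have lin: "(tf_coeff U (\<lambda>_. c) \<otimes>\<^bsub>tf_ring U\<^esub> tf_var U j \<otimes>\<^bsub>tf_ring U\<^esub> tf_dz i f) \<alpha> x
      = c * zmult j (zderiv i (\<lambda>\<alpha>. f \<alpha> x)) \<alpha>" for c i j
  proof -
    have "tf_coeff U (\<lambda>_. c) \<otimes>\<^bsub>tf_ring U\<^esub> tf_var U j \<otimes>\<^bsub>tf_ring U\<^esub> tf_dz i f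
        = tf_coeff U (\<lambda>_. c) \<otimes>\<^bsub>tf_ring U\<^esub> (tf_var U j \<otimes>\<^bsub>tf_ring U\<^esub> tf_dz i f)"
      using f by (intro m_assoc) (auto intro!: tf_coeff_closed tf_var_closed tf_dz_closed)
    thus ?thesis
      using \<open>x \<in> U\<close> conv_var_left[of j] by (simp add: tf_mult_apply coeff dz tf_var_apply)
  qed
  have dx: "(tf_coeff U (\<lambda>x. x) \<otimes>\<^bsub>tf_ring U\<^esub> tf_dx U f) \<alpha> x = x * deriv (f \<alpha>) x"
    using \<open>x \<in> U\<close> by (simp add: tf_mult_apply coeff tf_dx_def)
  have bdz: "(b i \<otimes>\<^bsub>tf_ring U\<^esub> tf_dz i f) \<alpha> x = conv (\<lambda>\<alpha>. b i \<alpha> x) (zderiv i (\<lambda>\<alpha>. f \<alpha> x)) \<alpha>" for i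
    by (simp add: tf_mult_apply dz)
  show ?thesis
    by (simp add: x_normal_form_def Let_def tf_ring_simps(5) tf_finsum_apply closed finsum_closed lin
        linear_field_def dx bdz Pi_def)
qed

lemma tf_minus: "f \<in> carrier (tf_ring U) \<Longrightarrow> \<ominus>\<^bsub>tf_ring U\<^esub> f = (\<lambda>\<alpha> x. - f \<alpha> x)"
proof -
  interpret cring "tf_ring U :: ('a::finite) tf_series ring" by (rule cring_tf_ring)
  assume f: "f \<in> carrier (tf_ring U)"
  show ?thesis
    by (rule minus_equality) (use f in \<open>auto simp: tf_ring_simps intro!: holomorphic_intros\<close>)
qed

section \<open>The ideal generated by the quadratic monomials\<close>

text \<open>Describes \<open>quadratic_ideal\<close> by a condition on coefficients;
  \<open>quadratic_ideal_eq\<close> proves the equality.\<close>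

definition order_ge_2 :: "complex set \<Rightarrow> ('n::finite) tf_series set" where
  "order_ge_2 U = {f \<in> carrier (tf_ring U). \<forall>\<alpha> x. sum \<alpha> UNIV < 2 \<longrightarrow> f \<alpha> x = 0}"

lemma multi_index_sum_eq:
  "(\<lambda>i. \<beta> i + \<gamma> i) = \<alpha> \<Longrightarrow> sum \<beta> UNIV + sum \<gamma> UNIV = sum (\<alpha> :: 'n::finite \<Rightarrow> nat) UNIV"
  by (auto simp: sum.distrib)

text \<open>Degrees add in a product, so a coefficient of degree below 2 involves only coefficients
  of degree below 2 of each factor.\<close>

lemma ideal_order_ge_2: "ideal (order_ge_2 U :: ('n::finite) tf_series set) (tf_ring U)"
proof -
  interpret cring "tf_ring U :: 'n tf_series ring" by (rule cring_tf_ring)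
  have mult: "f \<otimes>\<^bsub>tf_ring U\<^esub> g \<in> order_ge_2 U"
    if "f \<in> order_ge_2 U" "g \<in> carrier (tf_ring U)" for f g :: "'n tf_series"
  proof -
    have "(f \<otimes>\<^bsub>tf_ring U\<^esub> g) \<alpha> x = 0" if "sum \<alpha> UNIV < 2" for \<alpha> x
      unfolding tf_ring_simps
    proof (intro sum.neutral ballI, clarify)
      fix \<beta> \<gamma> assume "\<alpha> = (\<lambda>i. \<beta> i + \<gamma> i)"
      hence "sum \<beta> UNIV < 2" using that multi_index_sum_eq[of \<beta> \<gamma> \<alpha>] by simp
      thus "f \<beta> x * g \<gamma> x = 0" using \<open>f \<in> order_ge_2 U\<close> by (simp add: order_ge_2_def)
    qed
    thus ?thesis using that by (auto simp: order_ge_2_def)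
  qed
  show ?thesis
  proof (rule idealI[OF ring_axioms])
    show "subgroup (order_ge_2 U :: 'n tf_series set) (add_monoid (tf_ring U))"
    proof
      show "inv\<^bsub>add_monoid (tf_ring U)\<^esub> f \<in> order_ge_2 U" if "f \<in> order_ge_2 U" for f :: "'n tf_series"
        using that tf_minus[of f U] a_inv_closed[of f]
        unfolding a_inv_def[symmetric] by (auto simp: order_ge_2_def)
    qed (auto simp: order_ge_2_def tf_ring_simps intro!: holomorphic_intros)
    show "g \<otimes>\<^bsub>tf_ring U\<^esub> f \<in> order_ge_2 U" if "f \<in> order_ge_2 U" "g \<in> carrier (tf_ring U)"
      for f g :: "'n tf_series"
      using mult[OF that] m_comm[of g f] that by (simp add: order_ge_2_def)
  qed (rule mult)
qed

text \<open>A nonzero coefficient occurs only at the sum of the unit multi-indices of k and l, which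
  has degree 2.\<close>

lemma quadratic_monomial_order_ge_2: "tf_var U k \<otimes>\<^bsub>tf_ring U\<^esub> tf_var U l \<in> order_ge_2 U"
proof -
  interpret cring "tf_ring U :: ('a::finite) tf_series ring" by (rule cring_tf_ring)
  have closed: "tf_var U k \<otimes>\<^bsub>tf_ring U\<^esub> tf_var U l \<in> carrier (tf_ring U)"
    by (intro m_closed tf_var_closed)
  have "(tf_var U k \<otimes>\<^bsub>tf_ring U\<^esub> tf_var U l) \<alpha> x = 0" if "sum \<alpha> UNIV < 2" for \<alpha> x
  proof (cases "x \<in> U")
    case True
    have "(tf_var U k \<otimes>\<^bsub>tf_ring U\<^esub> tf_var U l) \<alpha> x = zmult k (monomial ((\<lambda>_. 0)(l := 1))) \<alpha>"
      using True conv_var_left[of k] by (simp add: tf_mult_apply tf_var_apply)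
    also have "\<dots> = 0"
    proof (rule ccontr)
      assume *: "\<not> ?thesis"
      hence "\<alpha> k \<noteq> 0" "\<alpha>(k := \<alpha> k - 1) = (\<lambda>_. 0)(l := Suc 0)"
        by (auto simp: zmult_def monomial_def split: if_splits)
      hence "sum \<alpha> UNIV = Suc (sum ((\<lambda>_. 0)(l := Suc 0)) UNIV)"
        using sum_fun_upd_diff[of \<alpha> k] by simp
      also have "\<dots> = 2" using sum_fun_upd_Suc[of "\<lambda>_. 0" l] by simp
      finally show False using that by simp
    qed
    finally show ?thesis .
  qed (use closed in \<open>simp add: tf_ring_simps(1)\<close>)
  thus ?thesis using closed by (simp add: order_ge_2_def)
qed
text \<open>For every multi-index \<open>\<alpha>\<close> of order at least 2 select one quadratic monomial dividing \<open>z\<^sup>\<alpha>\<close>,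
  and collect the terms with the same selected monomial.\<close>

lemma quadratic_ideal_eq: "quadratic_ideal U = (order_ge_2 U :: ('n::finite) tf_series set)"
proof
  let ?G = "{tf_var U k \<otimes>\<^bsub>tf_ring U\<^esub> tf_var U l | k l. True} :: 'n tf_series set"
  interpret cring "tf_ring U :: 'n tf_series ring" by (rule cring_tf_ring)
  show "quadratic_ideal U \<subseteq> (order_ge_2 U :: 'n tf_series set)"
    unfolding quadratic_ideal_def
    by (rule genideal_minimal[OF ideal_order_ge_2]) (use quadratic_monomial_order_ge_2 in auto)
  have G: "?G \<subseteq> carrier (tf_ring U)" by (auto intro!: m_closed tf_var_closed)
  interpret I: ideal "quadratic_ideal U" "tf_ring U :: 'n tf_series ring"
    unfolding quadratic_ideal_def by (rule genideal_ideal[OF G])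
  show "(order_ge_2 U :: 'n tf_series set) \<subseteq> quadratic_ideal U"
  proof
    fix f :: "'n tf_series" assume f: "f \<in> order_ge_2 U"
    have ex: "\<exists>p. \<alpha> (fst p) \<noteq> 0 \<and> (\<alpha>(fst p := \<alpha> (fst p) - 1)) (snd p) \<noteq> 0"
      if \<alpha>: "sum \<alpha> UNIV \<ge> 2" for \<alpha> :: "'n \<Rightarrow> nat"
    proof -
      have nz: "\<exists>k. \<beta> k \<noteq> 0" if "sum \<beta> UNIV \<noteq> 0" for \<beta> :: "'n \<Rightarrow> nat"
        using that by auto
      have "sum \<alpha> UNIV \<noteq> 0" using \<alpha> by linarith
      from nz[OF this] obtain k where k: "\<alpha> k \<noteq> 0" ..
      hence "sum (\<alpha>(k := \<alpha> k - 1)) UNIV \<noteq> 0" using \<alpha> sum_fun_upd_diff[of \<alpha> k] by linarith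
      from nz[OF this] obtain l where "(\<alpha>(k := \<alpha> k - 1)) l \<noteq> 0" ..
      thus ?thesis using k by (intro exI[of _ "(k, l)"]) simp
    qed
    \<comment> \<open>The second index is tested after lowering the first, so a selected pair (k, k)
      requires \<open>\<alpha> k \<ge> 2\<close>.\<close>
    define sel where "sel = (\<lambda>\<alpha> :: 'n \<Rightarrow> nat.
        SOME p. \<alpha> (fst p) \<noteq> 0 \<and> (\<alpha>(fst p := \<alpha> (fst p) - 1)) (snd p) \<noteq> 0)"
    have sel: "\<alpha> (fst (sel \<alpha>)) \<noteq> 0 \<and> (\<alpha>(fst (sel \<alpha>) := \<alpha> (fst (sel \<alpha>)) - 1)) (snd (sel \<alpha>)) \<noteq> 0"
      if "sum \<alpha> UNIV \<ge> 2" for \<alpha> :: "'n \<Rightarrow> nat"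
      unfolding sel_def by (rule someI_ex) (rule ex[OF that])
    define up where "up = (\<lambda>k (\<beta> :: 'n \<Rightarrow> nat). \<beta>(k := Suc (\<beta> k)))"
    \<comment> \<open>\<open>c p\<close> collects the terms of f whose multi-index selects p,
      divided by that quadratic monomial.\<close>
    define c where "c = (\<lambda>p \<beta>. if sel (up (fst p) (up (snd p) \<beta>)) = p
        then f (up (fst p) (up (snd p) \<beta>)) else (\<lambda>_. 0))"
    define g where "g = (\<lambda>p. c p \<otimes>\<^bsub>tf_ring U\<^esub> (tf_var U (fst p) \<otimes>\<^bsub>tf_ring U\<^esub> tf_var U (snd p)))"
    have c: "c p \<in> carrier (tf_ring U)" for p
      using f by (auto simp: c_def order_ge_2_def tf_ring_simps)
    have g: "g p \<in> quadratic_ideal U" for p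
    proof -
      have "tf_var U (fst p) \<otimes>\<^bsub>tf_ring U\<^esub> tf_var U (snd p) \<in> quadratic_ideal U"
        unfolding quadratic_ideal_def by (rule subsetD[OF genideal_self[OF G]]) blast
      thus ?thesis unfolding g_def using c by (rule I.I_l_closed)
    qed
    have "(\<lambda>\<alpha> x. \<Sum>p\<in>F. g p \<alpha> x) \<in> quadratic_ideal U" if "finite F" for F
      using that
    proof induction
      case empty
      thus ?case using I.zero_closed by (simp add: tf_ring_simps(4))
    next
      case (insert p F)
      from I.a_closed[OF g[of p] insert.IH] insert.hyps show ?case
        by (simp add: tf_ring_simps(5))
    qed
    hence "(\<lambda>\<alpha> x. \<Sum>p\<in>UNIV. g p \<alpha> x) \<in> quadratic_ideal U" by simp
    moreover have "(\<Sum>p\<in>UNIV. g p \<alpha> x) = f \<alpha> x" for \<alpha> x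
    proof (cases "x \<in> U")
      case True
      \<comment> \<open>Each coefficient of f is contributed by exactly one of the finitely many
        pairs p.\<close>
      have gp: "g p \<alpha> x = (if sum \<alpha> UNIV \<ge> 2 \<and> p = sel \<alpha> then f \<alpha> x else 0)" for p
      proof -
        obtain k l where p: "p = (k, l)" by fastforce
        have "g p = tf_var U k \<otimes>\<^bsub>tf_ring U\<^esub> (tf_var U l \<otimes>\<^bsub>tf_ring U\<^esub> c p)"
          using c[of p] tf_var_closed[of U k] tf_var_closed[of U l]
          by (simp add: g_def p m_ac)
        hence "g p \<alpha> x = zmult k (zmult l (\<lambda>\<beta>. c p \<beta> x)) \<alpha>"
          using True conv_var_left[of k] conv_var_left[of l] by (simp add: tf_mult_apply tf_var_apply)
        also have "\<dots> = (if sum \<alpha> UNIV \<ge> 2 \<and> p = sel \<alpha> then f \<alpha> x else 0)"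
        proof (cases "\<alpha> k = 0 \<or> (\<alpha>(k := \<alpha> k - 1)) l = 0")
          case True
          hence "zmult k (zmult l (\<lambda>\<beta>. c p \<beta> x)) \<alpha> = 0"
            by (cases "\<alpha> k = 0") (simp_all add: zmult_def)
          moreover have "\<not> (sum \<alpha> UNIV \<ge> 2 \<and> p = sel \<alpha>)"
          proof
            assume *: "sum \<alpha> UNIV \<ge> 2 \<and> p = sel \<alpha>"
            hence "sel \<alpha> = (k, l)" using p by simp
            with sel[of \<alpha>] * True show False by (simp only: fst_conv snd_conv) blast
          qed
          ultimately show ?thesis by (simp only: if_False)
        next
          case False
          let ?\<alpha>' = "\<alpha>(k := \<alpha> k - 1)"
          let ?\<beta> = "?\<alpha>'(l := ?\<alpha>' l - 1)"
          have up: "up l ?\<beta> = ?\<alpha>'" "up k ?\<alpha>' = \<alpha>"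
            using False by (auto simp: up_def fun_eq_iff)
          have "Suc (sum ?\<beta> UNIV) = sum ?\<alpha>' UNIV" "Suc (sum ?\<alpha>' UNIV) = sum \<alpha> UNIV"
            using False sum_fun_upd_diff[of ?\<alpha>' l] sum_fun_upd_diff[of \<alpha> k] by auto
          hence "sum \<alpha> UNIV \<ge> 2" by linarith
          moreover have "zmult k (zmult l (\<lambda>\<beta>. c p \<beta> x)) \<alpha> = c p ?\<beta> x"
            unfolding zmult_def using False by (simp only: de_Morgan_disj if_False)
          moreover have "c p ?\<beta> x = (if sel \<alpha> = p then f \<alpha> x else 0)"
            unfolding c_def p fst_conv snd_conv up by simp
          ultimately show ?thesis by auto
        qed
        finally show ?thesis .
      qed
      show ?thesis using f by (cases "sum \<alpha> UNIV < 2") (simp_all add: gp order_ge_2_def)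
    next
      case False
      have "g p \<in> carrier (tf_ring U)" for p using g I.Icarr by blast
      thus ?thesis using f False by (simp add: tf_ring_simps(1) order_ge_2_def)
    qed
    ultimately show "f \<in> quadratic_ideal U" by simp
  qed
qed

section \<open>Extension of the coefficients\<close>

text \<open>Only values on V enter, so the zero convention outside the annulus does not interfere
  with extension to the disc.\<close>

definition extends_to :: "complex set \<Rightarrow> complex set \<Rightarrow> (complex \<Rightarrow> complex) \<Rightarrow> bool" where
  "extends_to U V g \<longleftrightarrow> (\<exists>h. h holomorphic_on U \<and> (\<forall>x\<in>V. h x = g x))"

lemma extends_to_holomorphic: "g holomorphic_on U \<Longrightarrow> extends_to U V g"
  by (auto simp: extends_to_def)

lemma extends_to_zero: "(\<And>x. x \<in> V \<Longrightarrow> g x = 0) \<Longrightarrow> extends_to U V g"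
  unfolding extends_to_def by (intro exI[of _ "\<lambda>_. 0"]) auto

lemma extends_to_add: "extends_to U V f \<Longrightarrow> extends_to U V g \<Longrightarrow> extends_to U V (\<lambda>x. f x + g x)"
  unfolding extends_to_def
  by (elim exE conjE, rule_tac x = "\<lambda>x. h x + ha x" in exI) (auto intro: holomorphic_intros)

lemma extends_to_diff: "extends_to U V f \<Longrightarrow> extends_to U V g \<Longrightarrow> extends_to U V (\<lambda>x. f x - g x)"
  unfolding extends_to_def
  by (elim exE conjE, rule_tac x = "\<lambda>x. h x - ha x" in exI) (auto intro: holomorphic_intros)

lemma extends_to_mult: "extends_to U V f \<Longrightarrow> extends_to U V g \<Longrightarrow> extends_to U V (\<lambda>x. f x * g x)"
  unfolding extends_to_def
  by (elim exE conjE, rule_tac x = "\<lambda>x. h x * ha x" in exI) (auto intro: holomorphic_intros)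

lemma extends_to_sum:
  "(\<And>i. i \<in> I \<Longrightarrow> extends_to U V (f i)) \<Longrightarrow> extends_to U V (\<lambda>x. \<Sum>i\<in>I. f i x)"
  by (induction I rule: infinite_finite_induct) (auto intro: extends_to_add extends_to_zero)

lemma zmult_zderiv_holomorphic:
  assumes "\<And>\<alpha>. F \<alpha> holomorphic_on U"
  shows "(\<lambda>x. zmult j (zderiv i (\<lambda>\<alpha>. F \<alpha> x)) \<alpha>) holomorphic_on U"
  using assms by (cases "\<alpha> j = 0") (auto simp: zmult_def zderiv_def intro!: holomorphic_intros)

lemma linear_field_holomorphic:
  "(\<And>\<alpha>. F \<alpha> holomorphic_on U) \<Longrightarrow> (\<lambda>x. linear_field A (\<lambda>\<alpha>. F \<alpha> x) \<alpha>) holomorphic_on U"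
  unfolding linear_field_def by (intro holomorphic_intros zmult_zderiv_holomorphic)

lemma sum_pair_mem: "p \<in> {(\<beta>, \<gamma>). (\<lambda>i. \<beta> i + \<gamma> i) = \<alpha>} \<Longrightarrow>
    sum (fst p) UNIV + sum (snd p) UNIV = sum (\<alpha> :: 'n::finite \<Rightarrow> nat) UNIV"
  using multi_index_sum_eq[of "fst p" "snd p" \<alpha>] by (auto simp: case_prod_unfold)

text \<open>Since \<open>b\<close> has order at least 2, the terms with a coefficient of \<open>c\<close> of degree \<open>\<ge> \<bar>\<alpha>\<bar>\<close> vanish.\<close>

lemma extends_to_conv_zderiv:
  fixes b c :: "('n::finite) tf_series"
  assumes b: "\<And>\<alpha>. b \<alpha> holomorphic_on U"
    and b0: "\<And>\<alpha> x. sum \<alpha> UNIV < 2 \<Longrightarrow> x \<in> V \<Longrightarrow> b \<alpha> x = 0"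
    and c: "\<And>\<beta>. sum \<beta> UNIV < sum \<alpha> UNIV \<Longrightarrow> extends_to U V (c \<beta>)"
  shows "extends_to U V (\<lambda>x. conv (\<lambda>\<alpha>. c \<alpha> x) (zderiv j (\<lambda>\<alpha>. b \<alpha> x)) \<alpha>)"
    and "extends_to U V (\<lambda>x. conv (\<lambda>\<alpha>. b \<alpha> x) (zderiv j (\<lambda>\<alpha>. c \<alpha> x)) \<alpha>)"
  unfolding conv_def case_prod_unfold
proof (rule_tac [!] extends_to_sum)
  fix p assume p: "p \<in> {p. (\<lambda>i. fst p i + snd p i) = \<alpha>}"
  hence deg: "sum (fst p) UNIV + sum (snd p) UNIV = sum \<alpha> UNIV"
    using sum_pair_mem[of p \<alpha>] by (auto simp: case_prod_unfold)
  show "extends_to U V (\<lambda>x. c (fst p) x * zderiv j (\<lambda>\<alpha>. b \<alpha> x) (snd p))"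
  proof (cases "sum (snd p) UNIV = 0")
    \<comment> \<open>The derivative reads a coefficient of b of degree 1, which vanishes.\<close>
    case True
    thus ?thesis
      using b0 sum_fun_upd_Suc[of "snd p" j] by (intro extends_to_zero) (simp add: zderiv_def)
  next
    case False
    hence "sum (fst p) UNIV < sum \<alpha> UNIV" using deg by linarith
    thus ?thesis using b unfolding zderiv_def
      by (intro extends_to_mult c extends_to_holomorphic holomorphic_intros) auto
  qed
  show "extends_to U V (\<lambda>x. b (fst p) x * zderiv j (\<lambda>\<alpha>. c \<alpha> x) (snd p))"
  proof (cases "sum (fst p) UNIV < 2")
    case True
    thus ?thesis using b0 by (intro extends_to_zero) simp
  next
    \<comment> \<open>The factor b uses at least degree 2 and the derivative raises the other index
      by 1, so c is read in degree at most \<open>sum \<alpha> UNIV - 1\<close>.\<close>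
    case False
    thus ?thesis using deg b sum_fun_upd_Suc[of "snd p" j] unfolding zderiv_def
      by (intro extends_to_mult c extends_to_holomorphic holomorphic_intros) auto
  qed
qed

section \<open>Induction on the degree of the coefficients\<close>

text \<open>Here b and c are the nonlinear coefficients of X and Y, and B is the linear part of Y.
  The assumption \<open>eq\<close> compares coefficients of \<open>X (Y z_k) = Y (X z_k)\<close> in
  degree at least 2.\<close>

lemma commuting_field_coefficients_extend:
  fixes b c :: "'n::finite \<Rightarrow> 'n tf_series" and A B :: "complex^'n^'n"
  assumes r: "0 < r" "r < R"
    and \<mu>: "eigenvalue_family A \<mu>" and res: "no_transverse_negative_resonance \<mu>"
    and b: "\<And>i \<alpha>. b i \<alpha> holomorphic_on ball 0 R"
    and c: "\<And>i \<alpha>. c i \<alpha> holomorphic_on annulus r R"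
    and b0: "\<And>i \<alpha> x. sum \<alpha> UNIV < 2 \<Longrightarrow> x \<in> annulus r R \<Longrightarrow> b i \<alpha> x = 0"
    and c0: "\<And>i \<alpha> x. sum \<alpha> UNIV < 2 \<Longrightarrow> x \<in> annulus r R \<Longrightarrow> c i \<alpha> x = 0"
    and eq: "\<And>k \<alpha> x. 2 \<le> sum \<alpha> UNIV \<Longrightarrow> x \<in> annulus r R \<Longrightarrow>
      x * deriv (c k \<alpha>) x + linear_field A (\<lambda>\<alpha>. c k \<alpha> x) \<alpha>
        + (\<Sum>j\<in>UNIV. B $ k $ j * b j \<alpha> x + conv (\<lambda>\<alpha>. b j \<alpha> x) (zderiv j (\<lambda>\<alpha>. c k \<alpha> x)) \<alpha>)
      = x * deriv (b k \<alpha>) x + linear_field B (\<lambda>\<alpha>. b k \<alpha> x) \<alpha>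
        + (\<Sum>j\<in>UNIV. A $ k $ j * c j \<alpha> x + conv (\<lambda>\<alpha>. c j \<alpha> x) (zderiv j (\<lambda>\<alpha>. b k \<alpha> x)) \<alpha>)"
  shows "extends_to (ball 0 R) (annulus r R) (c i \<alpha>)"
proof (induction "sum \<alpha> UNIV" arbitrary: i \<alpha> rule: less_induct)
  case less
  define m where "m = sum \<alpha> UNIV"
  show ?case
  proof (cases "m < 2")
    case True
    thus ?thesis using c0 by (intro extends_to_zero) (simp add: m_def)
  next
    case False
    \<comment> \<open>g gathers the terms of \<open>eq\<close> without coefficients of c in degree
      m; both convolutions involve c only in lower degree.\<close>
    define g where "g = (\<lambda>k \<gamma> x. x * deriv (b k \<gamma>) x + linear_field B (\<lambda>\<alpha>. b k \<alpha> x) \<gamma>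
        + (\<Sum>j\<in>UNIV. conv (\<lambda>\<alpha>. c j \<alpha> x) (zderiv j (\<lambda>\<alpha>. b k \<alpha> x)) \<gamma>)
        - (\<Sum>j\<in>UNIV. B $ k $ j * b j \<gamma> x + conv (\<lambda>\<alpha>. b j \<alpha> x) (zderiv j (\<lambda>\<alpha>. c k \<alpha> x)) \<gamma>))"
    have g: "extends_to (ball 0 R) (annulus r R) (g k \<gamma>)" if "sum \<gamma> UNIV = m" for k \<gamma>
    proof -
      have IH: "extends_to (ball 0 R) (annulus r R) (c j \<beta>)" if "sum \<beta> UNIV < sum \<gamma> UNIV" for j \<beta>
        using less[of \<beta> j] that \<open>sum \<gamma> UNIV = m\<close> by (simp add: m_def)
      show ?thesis unfolding g_def
        by (intro extends_to_diff extends_to_add extends_to_sum extends_to_conv_zderiv[OF b b0 IH]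
            extends_to_holomorphic holomorphic_intros linear_field_holomorphic b open_ball)
    qed
    have rel: "x * deriv (c k \<gamma>) x
        = g k \<gamma> x - linear_field A (\<lambda>\<alpha>. c k \<alpha> x) \<gamma> + (\<Sum>j\<in>UNIV. A $ k $ j * c j \<gamma> x)"
      if "sum \<gamma> UNIV = m" "x \<in> annulus r R" for k \<gamma> x
      using eq[of \<gamma> x k] that False by (simp add: g_def sum.distrib algebra_simps)
    have moment: "contour_integral (circlepath 0 s) (\<lambda>x. c i \<alpha> x * x ^ n) = 0"
      if s: "r < s" "s < R" for s n
    proof -
      \<comment> \<open>\<open>J h v\<close> says that the n-th moment of h exists and equals v, so
        integrability travels with the value.\<close>
      define J where "J = (\<lambda>h v. ((\<lambda>x. h x * x ^ n) has_contour_integral v) (circlepath 0 s))"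
      define I where "I = (\<lambda>k \<gamma>. contour_integral (circlepath 0 s) (\<lambda>x. c k \<gamma> x * x ^ n))"
      \<comment> \<open>\<open>I k\<close> has entries in all degrees; the spectral argument needs
        its homogeneous part of degree m.\<close>
      define P where "P = (\<lambda>k \<gamma>. if sum \<gamma> UNIV = m then I k \<gamma> else 0)"
      have sphere: "x \<in> annulus r R" if "x \<in> path_image (circlepath 0 s)" for x
        using that s r sphere_subset_annulus[of r s R] by auto
      have J_add: "J f v \<Longrightarrow> J h w \<Longrightarrow> J (\<lambda>x. f x + h x) (v + w)" for f h v w
        unfolding J_def using has_contour_integral_add by (simp add: distrib_right)
      have J_diff: "J f v \<Longrightarrow> J h w \<Longrightarrow> J (\<lambda>x. f x - h x) (v - w)" for f h v w
        unfolding J_def using has_contour_integral_diff by (simp add: left_diff_distrib)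
      have J_scale: "J f v \<Longrightarrow> J (\<lambda>x. a * f x) (a * v)" for f v a
        unfolding J_def using has_contour_integral_lmul by (simp add: mult.assoc)
      have J_sum: "(\<And>j. J (f j) (v j)) \<Longrightarrow> J (\<lambda>x. \<Sum>j\<in>UNIV. f j x) (\<Sum>j\<in>UNIV. v j)"
        for f :: "'n \<Rightarrow> complex \<Rightarrow> complex" and v
        unfolding J_def using has_contour_integral_sum[of UNIV "\<lambda>j x. f j x * x ^ n"]
        by (simp add: sum_distrib_right)
      have J_c: "J (c k \<gamma>) (I k \<gamma>)" for k \<gamma>
        unfolding J_def I_def
        by (intro has_contour_integral_integral contour_integrable_annulus[of _ r R] holomorphic_intros c)
           (use r s in auto)
      have J_lin: "J (\<lambda>x. linear_field A (\<lambda>\<alpha>. c k \<alpha> x) \<gamma>) (linear_field A (I k) \<gamma>)" for k \<gamma>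
        unfolding linear_field_def
      proof (intro J_sum J_scale)
        fix i j
        show "J (\<lambda>x. zmult j (zderiv i (\<lambda>\<alpha>. c k \<alpha> x)) \<gamma>) (zmult j (zderiv i (I k)) \<gamma>)"
        proof (cases "\<gamma> j = 0")
          case True
          thus ?thesis by (simp add: zmult_def J_def has_contour_integral_0)
        next
          case False
          thus ?thesis using J_scale[OF J_c] by (simp add: zmult_def zderiv_def del: of_nat_Suc)
        qed
      qed
      \<comment> \<open>g agrees on the circle with a function holomorphic in the disc, so Cauchy's
        theorem applies.\<close>
      have J_g: "J (g k \<gamma>) 0" if \<gamma>: "sum \<gamma> UNIV = m" for k \<gamma>
      proof -
        obtain h where h: "h holomorphic_on ball 0 R" "\<And>x. x \<in> annulus r R \<Longrightarrow> h x = g k \<gamma> x"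
          using g[OF \<gamma>] unfolding extends_to_def by blast
        have "((\<lambda>x. h x * x ^ n) has_contour_integral 0) (circlepath 0 s)"
          by (rule Cauchy_theorem_disc_simple[of _ 0 R])
             (use h r s in \<open>auto intro!: holomorphic_intros\<close>)
        thus ?thesis unfolding J_def
          by (rule has_contour_integral_eq) (use h(2) sphere in auto)
      qed
      \<comment> \<open>Two evaluations of the moment of x c' are compared: by parts, and through
        \<open>rel\<close>. The n-th moment belongs to Laurent index -(n + 1), whence the factor
        \<open>Suc n\<close>.\<close>
      have ode: "linear_field A (I k) \<gamma> = (\<Sum>j\<in>UNIV. A $ k $ j * I j \<gamma>) + of_nat (Suc n) * I k \<gamma>"
        if \<gamma>: "sum \<gamma> UNIV = m" for k \<gamma>
      proof -
        have "J (\<lambda>x. x * deriv (c k \<gamma>) x) (contour_integral (circlepath 0 s) (\<lambda>x. x * deriv (c k \<gamma>) x * x ^ n))"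
          unfolding J_def
          by (intro has_contour_integral_integral contour_integrable_annulus[of _ r R] holomorphic_intros c
              open_annulus) (use r s in auto)
        also have "contour_integral (circlepath 0 s) (\<lambda>x. x * deriv (c k \<gamma>) x * x ^ n)
            = - of_nat (Suc n) * I k \<gamma>"
          using contour_integral_Euler_by_parts[OF c _ s(1,2), of "Suc n" k \<gamma>] r by (simp add: I_def)
        finally have "J (\<lambda>x. x * deriv (c k \<gamma>) x) (- of_nat (Suc n) * I k \<gamma>)" .
        moreover have "J (\<lambda>x. x * deriv (c k \<gamma>) x)
            (0 - linear_field A (I k) \<gamma> + (\<Sum>j\<in>UNIV. A $ k $ j * I j \<gamma>))"
        proof -
          have "J (\<lambda>x. g k \<gamma> x - linear_field A (\<lambda>\<alpha>. c k \<alpha> x) \<gamma> + (\<Sum>j\<in>UNIV. A $ k $ j * c j \<gamma> x))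
            (0 - linear_field A (I k) \<gamma> + (\<Sum>j\<in>UNIV. A $ k $ j * I j \<gamma>))"
            by (intro J_add J_diff J_sum J_scale J_lin J_c J_g[OF \<gamma>])
          thus ?thesis unfolding J_def
            by (rule has_contour_integral_eq) (use rel[OF \<gamma>] sphere in auto)
        qed
        ultimately have "- of_nat (Suc n) * I k \<gamma>
            = 0 - linear_field A (I k) \<gamma> + (\<Sum>j\<in>UNIV. A $ k $ j * I j \<gamma>)"
          unfolding J_def by (rule has_contour_integral_unique)
        thus ?thesis by (simp add: algebra_simps)
      qed
      have hom: "P k \<in> homogeneous m" for k by (simp add: P_def homogeneous_def)
      have "P i = (\<lambda>_. 0)"
      proof (rule nonresonant_homogeneous_trivial[OF \<mu> res _ _ hom])
        show "linear_field A (P k) = (\<lambda>\<gamma>. (\<Sum>j\<in>UNIV. A $ k $ j * P j \<gamma>) + of_nat (Suc n) * P k \<gamma>)" for k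
        proof
          fix \<gamma>
          show "linear_field A (P k) \<gamma> = (\<Sum>j\<in>UNIV. A $ k $ j * P j \<gamma>) + of_nat (Suc n) * P k \<gamma>"
          proof (cases "sum \<gamma> UNIV = m")
            case True
            hence "linear_field A (P k) \<gamma> = linear_field A (I k) \<gamma>"
              by (intro linear_field_cong) (simp add: P_def)
            thus ?thesis using True ode[OF True] by (simp add: P_def)
          next
            case False
            thus ?thesis using linear_field_homogeneous[OF hom, of A k] by (simp add: homogeneous_def P_def)
          qed
        qed
      qed (use False in auto)
      thus ?thesis by (simp add: P_def I_def m_def fun_eq_iff split: if_splits)
    qed
    obtain h where "h holomorphic_on ball 0 R" "\<And>x. x \<in> annulus r R \<Longrightarrow> h x = c i \<alpha> x"
      using holomorphic_extension_annulus[OF c _ r(2) moment] r by auto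
    thus ?thesis unfolding extends_to_def by blast
  qed
qed

section \<open>The commutation relation on the coordinates z_k\<close>

lemma sum_unit_multi_index: "sum ((\<lambda>_. 0)(j := 1)) (UNIV :: 'n::finite set) = (1 :: nat)"
  using sum_fun_upd_Suc[of "\<lambda>_. 0" j] by simp

lemma zderiv_var: "zderiv i (monomial ((\<lambda>_. 0)(k := 1))) = (\<lambda>\<alpha>. if i = k then monomial (\<lambda>_. 0) \<alpha> else 0)"
proof
  fix \<alpha>
  have "\<alpha>(i := Suc (\<alpha> i)) = (\<lambda>_. 0)(k := Suc 0) \<longleftrightarrow> i = k \<and> \<alpha> = (\<lambda>_. 0)"
    by (auto simp: fun_eq_iff split: if_splits)
  thus "zderiv i (monomial ((\<lambda>_. 0)(k := 1))) \<alpha> = (if i = k then monomial (\<lambda>_. 0) \<alpha> else 0)"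
    by (auto simp: zderiv_def monomial_def)
qed

lemma zmult_monomial_0: "zmult j (monomial (\<lambda>_. 0)) = monomial ((\<lambda>_. 0)(j := 1))"
proof
  fix \<alpha>
  have "\<alpha> = (\<lambda>_. 0)(j := Suc 0) \<longleftrightarrow> \<alpha> j \<noteq> 0 \<and> \<alpha>(j := \<alpha> j - 1) = (\<lambda>_. 0)"
    by (auto simp: fun_eq_iff split: if_splits)
  thus "zmult j (monomial (\<lambda>_. 0)) \<alpha> = monomial ((\<lambda>_. 0)(j := 1)) \<alpha>"
    by (auto simp: zmult_def monomial_def)
qed

lemma x_normal_form_var:
  fixes A :: "complex^'n::finite^'n"
  assumes "open V" "x \<in> V" and b: "\<And>i. b i \<in> carrier (tf_ring V)"
  shows "x_normal_form V A b (tf_var V k) \<alpha> x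
    = (\<Sum>j\<in>UNIV. A $ k $ j * monomial ((\<lambda>_. 0)(j := 1)) \<alpha>) + b k \<alpha> x"
proof -
  let ?e = "\<lambda>k :: 'n. monomial ((\<lambda>_. 0)(k := 1))"
  \<comment> \<open>\<open>tf_var\<close> is cut off outside V, but constant near x because V is
    open.\<close>
  have "deriv (tf_var V k \<alpha>) x = deriv (\<lambda>_. ?e k \<alpha>) x"
    by (intro deriv_cong_ev eventually_mono[OF eventually_nhds_in_open[OF assms(1,2)]])
       (simp_all add: tf_var_apply)
  moreover have "(\<lambda>\<alpha>. tf_var V k \<alpha> x) = ?e k"
    using \<open>x \<in> V\<close> by (simp add: tf_var_apply fun_eq_iff)
  moreover have "linear_field A (?e k) \<alpha> = (\<Sum>i\<in>UNIV. if i = k then \<Sum>j\<in>UNIV. A $ k $ j * ?e j \<alpha> else 0)"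
    unfolding linear_field_def
  proof (intro sum.cong refl)
    fix i
    show "(\<Sum>j\<in>UNIV. A $ i $ j * zmult j (zderiv i (?e k)) \<alpha>) = (if i = k then \<Sum>j\<in>UNIV. A $ k $ j * ?e j \<alpha> else 0)"
      unfolding zderiv_var by (cases "i = k") (simp_all add: zmult_monomial_0[simplified], simp add: zmult_def)
  qed
  moreover have "(\<Sum>i\<in>UNIV. conv (\<lambda>\<alpha>. b i \<alpha> x) (zderiv i (?e k)) \<alpha>) = (\<Sum>i\<in>UNIV. if i = k then b i \<alpha> x else 0)"
  proof (intro sum.cong refl)
    fix i
    show "conv (\<lambda>\<alpha>. b i \<alpha> x) (zderiv i (?e k)) \<alpha> = (if i = k then b i \<alpha> x else 0)"
      unfolding zderiv_var by (cases "i = k") (simp_all add: conv_monomial_0_right, simp add: conv_def)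
  qed
  ultimately show ?thesis
    using x_normal_form_apply[OF assms(1,2) tf_var_closed b, where A = A and \<alpha> = \<alpha>] by simp
qed

text \<open>The inner field yields a linear form plus \<open>c k\<close>. In degree at least 2 the
  linear form is invisible to x d/dx and to the degree-preserving linear field; only its constant
  gradient, row k of B, survives and multiplies the b_j.\<close>

lemma x_normal_form_x_normal_form_var:
  fixes A B :: "complex^'n::finite^'n"
  assumes V: "open V" "x \<in> V"
    and b: "\<And>i. b i \<in> carrier (tf_ring V)" and c: "\<And>i. c i \<in> carrier (tf_ring V)"
    and w: "x_normal_form V B c (tf_var V k) \<in> carrier (tf_ring V)"
    and \<alpha>: "2 \<le> sum \<alpha> UNIV"
  shows "x_normal_form V A b (x_normal_form V B c (tf_var V k)) \<alpha> x
    = x * deriv (c k \<alpha>) x + linear_field A (\<lambda>\<alpha>. c k \<alpha> x) \<alpha>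
      + (\<Sum>j\<in>UNIV. B $ k $ j * b j \<alpha> x + conv (\<lambda>\<alpha>. b j \<alpha> x) (zderiv j (\<lambda>\<alpha>. c k \<alpha> x)) \<alpha>)"
proof -
  let ?w = "x_normal_form V B c (tf_var V k)" and ?e = "\<lambda>k :: 'n. monomial ((\<lambda>_. 0)(k := 1))"
  have wx: "?w \<beta> y = (\<Sum>j\<in>UNIV. B $ k $ j * ?e j \<beta>) + c k \<beta> y" if "y \<in> V" for \<beta> y
    by (rule x_normal_form_var[OF V(1) that c])
  have e0: "?e j \<beta> = 0" if "2 \<le> sum \<beta> UNIV" for j \<beta>
    using that sum_unit_multi_index[of j] by (auto simp: monomial_def)
  have high: "?w \<beta> y = c k \<beta> y" if "y \<in> V" "2 \<le> sum \<beta> UNIV" for \<beta> y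
    using wx[OF that(1)] e0[OF that(2)] by simp
  have "deriv (?w \<alpha>) x = deriv (c k \<alpha>) x"
    using \<alpha> high
    by (intro deriv_cong_ev eventually_mono[OF eventually_nhds_in_open[OF V]]) auto
  moreover have "linear_field A (\<lambda>\<alpha>. ?w \<alpha> x) \<alpha> = linear_field A (\<lambda>\<alpha>. c k \<alpha> x) \<alpha>"
    using \<alpha> V by (intro linear_field_cong) (simp add: high)
  moreover have "conv (\<lambda>\<alpha>. b i \<alpha> x) (zderiv i (\<lambda>\<alpha>. ?w \<alpha> x)) \<alpha>
      = B $ k $ i * b i \<alpha> x + conv (\<lambda>\<alpha>. b i \<alpha> x) (zderiv i (\<lambda>\<alpha>. c k \<alpha> x)) \<alpha>" for i
  proof -
    have "zderiv i (\<lambda>\<alpha>. ?w \<alpha> x)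
        = (\<lambda>\<beta>. (\<Sum>j\<in>UNIV. B $ k $ j * zderiv i (?e j) \<beta>) + zderiv i (\<lambda>\<alpha>. c k \<alpha> x) \<beta>)"
      using wx[OF V(2)] by (simp add: zderiv_def sum_distrib_left algebra_simps)
    also have "\<dots> = (\<lambda>\<beta>. B $ k $ i * monomial (\<lambda>_. 0) \<beta> + zderiv i (\<lambda>\<alpha>. c k \<alpha> x) \<beta>)"
      unfolding zderiv_var by (simp add: if_distrib[of "\<lambda>t. _ * t"] cong: if_cong)
    finally show ?thesis
      by (simp add: conv_add_right conv_scale_right conv_monomial_0_right)
  qed
  ultimately show ?thesis
    using x_normal_form_apply[OF V w b, where A = A and \<alpha> = \<alpha>] by simp
qed

section \<open>Reassembly of Y from coefficients on the disc\<close>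

theorem theorem3:
  fixes r R :: real
    and X Y :: "('n::finite) tf_series \<Rightarrow> 'n tf_series"
    and A :: "complex ^ 'n ^ 'n"
    and \<mu> :: "'n \<Rightarrow> complex"
  assumes "0 < r" and "r < R"
    and "x_normalized_linear (ball 0 R) (annulus r R) A X"
    and "eigenvalue_family A \<mu>"
    and "no_transverse_negative_resonance \<mu>"
    and "x_normalized (annulus r R) (annulus r R) Y"
    and "\<forall>f\<in>carrier (tf_ring (annulus r R)). lie_bracket (annulus r R) X Y f = \<zero>\<^bsub>tf_ring (annulus r R)\<^esub>"
  shows "x_normalized (ball 0 R) (annulus r R) Y"
proof -
  let ?U = "ball (0::complex) R" and ?V = "annulus r R"
  let ?R = "tf_ring ?V :: 'n tf_series ring"
  interpret cring ?R by (rule cring_tf_ring)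
  have VU: "?V \<subseteq> ?U" by (auto simp: annulus_def)
  obtain b0 where b0: "\<And>i. b0 i \<in> quadratic_ideal ?U"
    and X: "\<And>f. f \<in> carrier ?R \<Longrightarrow> X f = x_normal_form ?V A (\<lambda>i. tf_restrict ?V (b0 i)) f"
    and XR: "\<And>f. f \<in> carrier ?R \<Longrightarrow> X f \<in> carrier ?R"
    using assms(3) unfolding x_normalized_linear_def tf_derivation_def Let_def by blast
  obtain B c0 where c0: "\<And>i. c0 i \<in> quadratic_ideal ?V"
    and Y0: "\<And>f. f \<in> carrier ?R \<Longrightarrow> Y f = x_normal_form ?V B (\<lambda>i. tf_restrict ?V (c0 i)) f"
    and YR: "\<And>f. f \<in> carrier ?R \<Longrightarrow> Y f \<in> carrier ?R"
    and Yder: "tf_derivation ?V Y"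
    using assms(6) unfolding x_normalized_def x_normalized_linear_def tf_derivation_def Let_def by blast
  have c: "c0 i \<in> carrier ?R" "\<And>\<alpha> x. sum \<alpha> UNIV < 2 \<Longrightarrow> c0 i \<alpha> x = 0" for i
    using c0[of i] by (auto simp: quadratic_ideal_eq order_ge_2_def)
  have b: "b0 i \<in> carrier (tf_ring ?U)" "\<And>\<alpha> x. sum \<alpha> UNIV < 2 \<Longrightarrow> b0 i \<alpha> x = 0" for i
    using b0[of i] by (auto simp: quadratic_ideal_eq order_ge_2_def)
  have c_restrict: "tf_restrict ?V (c0 i) = c0 i" for i
    using c(1)[of i] by (auto simp: tf_restrict_def tf_ring_simps fun_eq_iff)
  \<comment> \<open>Ring computations take place over the annulus with b, while holomorphy on the
    disc is a property of \<open>b0\<close>.\<close>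
  define b where "b = (\<lambda>i. tf_restrict ?V (b0 i))"
  have bR: "b i \<in> carrier ?R" for i
    unfolding b_def using VU b(1) by (rule tf_restrict_closed)
  have b_apply: "b i \<alpha> x = b0 i \<alpha> x" if "x \<in> ?V" for i \<alpha> x
    using that by (simp add: b_def tf_restrict_def)
  have b_deriv: "deriv (b i \<alpha>) x = deriv (b0 i \<alpha>) x" if "x \<in> ?V" for i \<alpha> x
    using b_apply
    by (intro deriv_cong_ev eventually_mono[OF eventually_nhds_in_open[OF open_annulus that]]) auto
  note X = X[folded b_def] and Y = Y0[unfolded c_restrict]
  have comm: "X (Y f) = Y (X f)" if f: "f \<in> carrier ?R" for f
  proof -
    have "X (Y f) \<ominus>\<^bsub>?R\<^esub> Y (X f) = \<zero>\<^bsub>?R\<^esub>"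
      using assms(7) f by (simp add: lie_bracket_def)
    thus ?thesis
      using tf_minus[OF YR[OF XR[OF f]]] by (simp add: a_minus_def tf_ring_simps(4,5) fun_eq_iff)
  qed
  have ext: "extends_to ?U ?V (c0 i \<alpha>)" for i \<alpha>
  proof (rule commuting_field_coefficients_extend[OF assms(1,2,4,5), where b = b0 and B = B])
    show "b0 i \<alpha> holomorphic_on ball 0 R" "c0 i \<alpha> holomorphic_on annulus r R" for i \<alpha>
      using b(1)[of i] c(1)[of i] by (simp_all add: tf_ring_simps)
    fix k x and \<alpha> :: "'n \<Rightarrow> nat" assume \<alpha>: "2 \<le> sum \<alpha> (UNIV :: 'n set)" and x: "x \<in> ?V"
    let ?z = "tf_var ?V k :: 'n tf_series"
    have z: "?z \<in> carrier ?R" by (rule tf_var_closed)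
    have "X (Y ?z) \<alpha> x = Y (X ?z) \<alpha> x" using comm[OF z] by simp
    hence "x_normal_form ?V A b (x_normal_form ?V B c0 ?z) \<alpha> x
        = x_normal_form ?V B c0 (x_normal_form ?V A b ?z) \<alpha> x"
      using X[OF z] X[OF YR[OF z]] Y[OF z] Y[OF XR[OF z]] by simp
    moreover have "x_normal_form ?V B c0 ?z \<in> carrier ?R" "x_normal_form ?V A b ?z \<in> carrier ?R"
      using XR[OF z] YR[OF z] X[OF z] Y[OF z] by auto
    ultimately show "x * deriv (c0 k \<alpha>) x + linear_field A (\<lambda>\<alpha>. c0 k \<alpha> x) \<alpha>
        + (\<Sum>j\<in>UNIV. B $ k $ j * b0 j \<alpha> x + conv (\<lambda>\<alpha>. b0 j \<alpha> x) (zderiv j (\<lambda>\<alpha>. c0 k \<alpha> x)) \<alpha>)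
      = x * deriv (b0 k \<alpha>) x + linear_field B (\<lambda>\<alpha>. b0 k \<alpha> x) \<alpha>
        + (\<Sum>j\<in>UNIV. A $ k $ j * c0 j \<alpha> x + conv (\<lambda>\<alpha>. c0 j \<alpha> x) (zderiv j (\<lambda>\<alpha>. b0 k \<alpha> x)) \<alpha>)"
      using x \<alpha> by (simp add: x_normal_form_x_normal_form_var[OF open_annulus] bR c(1) b_apply b_deriv)
  qed (use b(2) c(2) in auto)
  then obtain h where h: "\<And>i \<alpha>. h i \<alpha> holomorphic_on ?U" "\<And>i \<alpha> x. x \<in> ?V \<Longrightarrow> h i \<alpha> x = c0 i \<alpha> x"
    unfolding extends_to_def by metis
  \<comment> \<open>The extensions h may take any values outside the disc; c' is set to 0 there, and
    to 0 in degree below 2, so that it lies in the ideal over the disc.\<close>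
  define c' where "c' = (\<lambda>i \<alpha> x. if sum \<alpha> (UNIV :: 'n set) < 2 \<or> x \<notin> ?U then 0 else h i \<alpha> x)"
  have "c' i \<alpha> holomorphic_on ?U" for i \<alpha>
    by (rule holomorphic_transform[of "if sum \<alpha> (UNIV :: 'n set) < 2 then (\<lambda>_. 0) else h i \<alpha>"])
       (use h(1)[of i \<alpha>] in \<open>auto simp: c'_def\<close>)
  hence "c' i \<in> order_ge_2 ?U" for i
    by (auto simp: order_ge_2_def tf_ring_simps c'_def)
  \<comment> \<open>Clearing the low degrees changes nothing on the annulus, where \<open>c0\<close>
    already has order at least 2.\<close>
  moreover have "tf_restrict ?V (c' i) = tf_restrict ?V (c0 i)" for i
    using h(2)[of _ i] c(2)[of _ i] VU by (auto simp: tf_restrict_def c'_def fun_eq_iff)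
  ultimately show ?thesis
    unfolding x_normalized_def x_normalized_linear_def quadratic_ideal_eq
    using Yder Y0 by (intro exI[of _ B] conjI exI[of _ c']) auto
qed

end
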